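(* In the setting below, let $b_1,\dots,b_n$ be prescribed positive numbers and let $w(0)\in W$. Consider the combinatorial Yamabe flow $\frac{dw_i(t)}{dt}=B_i(w(t))-b_i$, $i=1,\dots,n$, with initial value $w(0)$. Then the solution $w(t)$ exists and stays in $W$ for all $t\in[0,\infty)$, and converges exponentially fast as $t\to\infty$ to an admissible discrete conformal factor $w^*\in W$ for which the hyperbolic surface $\Sigma_{w^**l^0}$ has geodesic boundary components of lengths $b_1,\dots,b_n$, i.e. $B_i(w^* )=b_i$ for all $i$. That is, there are constants $C,\lambda_0>0$ with $|w_i(t)-w_i^*|\le Ce^{-\lambda_0 t}$ for all $i$ and $t\ge 0$.
   Context: Setting: $T^*$ is a triangulation of a closed surface $S$ with vertex set $T^0$; $\Sigma=S\setminus N(T^0)$ where $N(T^0)$ is a small open regular disjoint neighborhood of $T^0$; $\Sigma$ has boundary components labeled $1,\dots,n$. $T=T^*\cap\Sigma$ is the ideal triangulation with ideal edges $E$ and ideal faces $F$; $ij$ denotes the ideal edge between boundary components $i,j$ and $ijk$ the ideal face adjacent to boundary components $i,j,k$. A discrete hyperbolic metric is $l\in\mathbb{R}_+^{|E|}$. For each face $ijk$ there is a right-angled hyperbolic hexagon, unique up to isometry, with pairwise non-adjacent sides of lengths $l_{ij},l_{jk},l_{ki}$; gluing gives a hyperbolic surface $\Sigma_l$ with geodesic boundary. $\theta_i^f$ is the length of the hexagon side of face $f=ijk$ opposite to the side of length $l_{jk}$, given by $\cosh\theta_i^f=\frac{\cosh l_{jk}+\cosh l_{ki}\cosh l_{ij}}{\sinh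 l_{ki}\sinh l_{ij}}$. Fix $l^0\in\mathbb{R}_+^{|E|}$. $W=\{w\in\mathbb{R}^n: w_i+w_j>-\ln\cosh\frac{l^0_{ij}}{2}\ \forall ij\in E\}$ is the set of admissible discrete conformal factors; for $w\in W$, $l=w*l^0$ is given by $\cosh\frac{l_{ij}}{2}=e^{w_i+w_j}\cosh\frac{l^0_{ij}}{2}$, and $B_i(w)=\sum_{f\in F_i}\theta_i^f$ (with $F_i$ the set of faces adjacent to boundary component $i$) is the length of boundary component $i$ of $\Sigma_{w*l^0}$. *)

theory Defs
  imports "HOL-Analysis.Analysis"
begin

text \<open>Combinatorial model of the ideal triangulation T.
  Faces: a finite set F of abstract faces. Each face f has three corners c \<in> {0,1,2};
  vert f c is the boundary component (vertex of T^*) at corner c, and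
  edg f c is the ideal edge of f opposite to corner c (joining the boundary components
  at the two other corners). ends e gives the two endpoints of the edge e (in some order).
  Boundary components are the elements of a finite type 'v (playing the role of 1..n).\<close>

definition tri_data ::
  "'f set \<Rightarrow> ('f \<Rightarrow> nat \<Rightarrow> 'v) \<Rightarrow> ('f \<Rightarrow> nat \<Rightarrow> 'e) \<Rightarrow> ('e \<Rightarrow> 'v \<times> 'v) \<Rightarrow> bool" where
  "tri_data F vert edg ends \<longleftrightarrow>
     finite F \<and>
     (\<forall>f\<in>F. \<forall>c<3.
        ends (edg f c) = (vert f ((c+1) mod 3), vert f ((c+2) mod 3)) \<or>
        ends (edg f c) = (vert f ((c+2) mod 3), vert f ((c+1) mod 3))) \<and>
     \<comment> \<open>closed surface: every edge is glued from exactly two face sides\<close>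
     (\<forall>f\<in>F. \<forall>c<3. card {(g,d). g \<in> F \<and> d < 3 \<and> edg g d = edg f c} = 2) \<and>
     \<comment> \<open>every boundary component / vertex of T^0 occurs in the triangulation\<close>
     (\<forall>v. \<exists>f\<in>F. \<exists>c<3. vert f c = v)"

definition edges_of :: "'f set \<Rightarrow> ('f \<Rightarrow> nat \<Rightarrow> 'e) \<Rightarrow> 'e set" where
  "edges_of F edg = {edg f c | f c. f \<in> F \<and> c < 3}"

definition admissible ::
  "'f set \<Rightarrow> ('f \<Rightarrow> nat \<Rightarrow> 'e) \<Rightarrow> ('e \<Rightarrow> 'v \<times> 'v) \<Rightarrow> ('e \<Rightarrow> real) \<Rightarrow> ('v \<Rightarrow> real) set" where
  "admissible F edg ends l0 =
     {w. \<forall>e\<in>edges_of F edg. w (fst (ends e)) + w (snd (ends e)) > - ln (cosh (l0 e / 2))}"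

definition conf_len ::
  "('e \<Rightarrow> 'v \<times> 'v) \<Rightarrow> ('e \<Rightarrow> real) \<Rightarrow> ('v \<Rightarrow> real) \<Rightarrow> 'e \<Rightarrow> real" where
  "conf_len ends l0 w e =
     2 * arcosh (exp (w (fst (ends e)) + w (snd (ends e))) * cosh (l0 e / 2))"

text \<open>Side length theta_i^f of the right-angled hexagon of face f at corner c
  (opposite to the side of length l(edg f c)), for edge lengths l.\<close>
definition hex_theta :: "('f \<Rightarrow> nat \<Rightarrow> 'e) \<Rightarrow> ('e \<Rightarrow> real) \<Rightarrow> 'f \<Rightarrow> nat \<Rightarrow> real" where
  "hex_theta edg l f c =
     (let a = l (edg f c); b = l (edg f ((c+1) mod 3)); d = l (edg f ((c+2) mod 3))
      in arcosh ((cosh a + cosh b * cosh d) / (sinh b * sinh d)))"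

definition bdry_len ::
  "'f set \<Rightarrow> ('f \<Rightarrow> nat \<Rightarrow> 'v) \<Rightarrow> ('f \<Rightarrow> nat \<Rightarrow> 'e) \<Rightarrow> ('e \<Rightarrow> 'v \<times> 'v) \<Rightarrow> ('e \<Rightarrow> real)
     \<Rightarrow> ('v \<Rightarrow> real) \<Rightarrow> 'v \<Rightarrow> real" where
  "bdry_len F vert edg ends l0 w i =
     (\<Sum>(f,c)\<in>{(f,c). f \<in> F \<and> c < 3 \<and> vert f c = i}. hex_theta edg (conf_len ends l0 w) f c)"

definition yamabe_solution ::
  "'f set \<Rightarrow> ('f \<Rightarrow> nat \<Rightarrow> 'v) \<Rightarrow> ('f \<Rightarrow> nat \<Rightarrow> 'e) \<Rightarrow> ('e \<Rightarrow> 'v \<times> 'v) \<Rightarrow> ('e \<Rightarrow> real)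
     \<Rightarrow> ('v \<Rightarrow> real) \<Rightarrow> ('v \<Rightarrow> real) \<Rightarrow> (real \<Rightarrow> 'v \<Rightarrow> real) \<Rightarrow> bool" where
  "yamabe_solution F vert edg ends l0 b w0 w \<longleftrightarrow>
     w 0 = w0 \<and>
     (\<forall>t\<ge>0. w t \<in> admissible F edg ends l0) \<and>
     (\<forall>t\<ge>0. \<forall>i. ((\<lambda>s. w s i) has_real_derivative
                     (bdry_len F vert edg ends l0 (w t) i - b i)) (at t within {0..}))"

end

theory Submission
  imports Defs
begin

text \<open>In the conformal factors, the Jacobian of the three boundary arcs of a single hexagon is negative
  definite, by an explicit sum of squares. Hence the vector field \<open>B - b\<close> is monotone on the convex set of
  admissible factors, which makes solutions unique, and strongly monotone on compact convex subsets.
  A short edge, or a very negative conformal factor, makes an adjacent boundary component long;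
  with all factors bounded below, a large factor makes its component short. So \<open>B - b\<close> points into a compact
  polytope of admissible factors containing the initial value. There an Euler step is a self-map, whose
  Brouwer fixed point is \<open>w\<^sup>*\<close>; the flow exists in the polytope for all times, and strong monotonicity
  gives exponential convergence to \<open>w\<^sup>*\<close>.\<close>

section \<open>Autonomous differential equations\<close>

text \<open>The estimates degenerate as an edge length tends to 0 or to infinity, so each
  quantitative bound is stated for edge weights in an interval \<open>{\<delta>..R}\<close> with
  \<open>\<delta> > 0\<close>. The weight of an edge is \<open>ln (cosh (l / 2))\<close>: in it a
  conformal change is affine, so admissibility is a system of linear inequalities, segments of
  admissible factors stay admissible, and the trapping region can be a polytope. Its facets bound
  edge weights from below and single factors on both sides. On an edge facet only the sum of the
  field over the two endpoints has to be nonnegative.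

  What makes a single factor control its boundary component is a cancellation: at a corner, the
  weight of the opposite edge minus the weights of the two adjacent edges is
  \<open>- 2 * x $ i\<close> up to constants, whatever the other factors are. The lower bound of the
  polytope must be fixed before the upper one, which depends on it. Inwardness is needed on a collar
  of each facet and not only on the facet, because an Euler step has positive length.

  An arbitrary solution is only known to stay admissible, so uniqueness rests on monotonicity
  without a uniform constant.\<close>

lemma halfline_deriv_nonneg_imp_le:
  fixes f f' :: "real \<Rightarrow> real"
  assumes deriv: "\<And>t. t \<ge> 0 \<Longrightarrow> (f has_real_derivative f' t) (at t within {0..})"
    and nonneg: "\<And>t. t \<ge> 0 \<Longrightarrow> f' t \<ge> 0"
    and "0 \<le> t"
  shows "f 0 \<le> f t"
proof (rule DERIV_nonneg_imp_increasing_open[OF \<open>0 \<le> t\<close>])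
  fix s assume s: "0 < s" "s < t"
  have "at s within {0..} = at s"
    using s by (intro at_within_interior) (auto simp: interior_real_atLeast)
  then show "\<exists>y. DERIV f s :> y \<and> y \<ge> 0"
    using deriv[of s] nonneg[of s] s by auto
next
  have "continuous_on {0..} f"
    using deriv by (auto simp: continuous_on_eq_continuous_within intro!: DERIV_continuous)
  then show "continuous_on {0..t} f"
    by (rule continuous_on_subset) auto
qed

text \<open>By the monotonicity inequality, \<open>exp (2 * lam * t)\<close> times the squared
  distance is nonincreasing. The inequality is required only along the two curves, and
  \<open>lam\<close> is any real number: a positive one gives exponential decay,
  \<open>lam = 0\<close> gives uniqueness.\<close>

lemma strongly_monotone_flow_contracts:
  fixes x y :: "real \<Rightarrow> 'a::real_inner" and V :: "'a \<Rightarrow> 'a"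
  assumes x: "\<And>t. t \<ge> 0 \<Longrightarrow> (x has_vector_derivative V (x t)) (at t within {0..})"
    and y: "\<And>t. t \<ge> 0 \<Longrightarrow> (y has_vector_derivative V (y t)) (at t within {0..})"
    and mono: "\<And>t. t \<ge> 0 \<Longrightarrow>
      (x t - y t) \<bullet> (V (x t) - V (y t)) \<le> - lam * ((x t - y t) \<bullet> (x t - y t))"
    and "0 \<le> t"
  shows "norm (x t - y t) \<le> exp (- lam * t) * norm (x 0 - y 0)"
proof -
  let ?f = "\<lambda>t. - (exp (2 * lam * t) * ((x t - y t) \<bullet> (x t - y t)))"
  let ?f' = "\<lambda>t. - exp (2 * lam * t) *
    (2 * lam * ((x t - y t) \<bullet> (x t - y t)) + 2 * ((x t - y t) \<bullet> (V (x t) - V (y t))))"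
  have "?f 0 \<le> ?f t"
  proof (rule halfline_deriv_nonneg_imp_le[of ?f ?f'])
    fix s :: real assume s: "s \<ge> 0"
    have d: "((\<lambda>t. x t - y t) has_derivative (\<lambda>h. h *\<^sub>R (V (x s) - V (y s)))) (at s within {0..})"
      using has_vector_derivative_diff[OF x[OF s] y[OF s]]
      by (simp add: has_vector_derivative_def)
    have sq: "((\<lambda>t. (x t - y t) \<bullet> (x t - y t)) has_real_derivative
        2 * ((x s - y s) \<bullet> (V (x s) - V (y s)))) (at s within {0..})"
      unfolding has_field_derivative_def
      by (rule has_derivative_eq_rhs[OF has_derivative_inner[OF d d]])
        (auto simp: inner_commute algebra_simps)
    show "(?f has_real_derivative ?f' s) (at s within {0..})"
      by (rule derivative_eq_intros sq refl)+ (simp add: algebra_simps)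
    have "2 * lam * ((x s - y s) \<bullet> (x s - y s)) + 2 * ((x s - y s) \<bullet> (V (x s) - V (y s))) \<le> 0"
      using mono[OF s] by simp
    then show "?f' s \<ge> 0"
      by (simp add: mult_nonneg_nonpos)
  qed fact
  then have "exp (2 * lam * t) * (norm (x t - y t))\<^sup>2 \<le> (norm (x 0 - y 0))\<^sup>2"
    by (simp add: power2_norm_eq_inner)
  moreover have "exp (2 * lam * t) = (exp (lam * t))\<^sup>2"
    by (simp add: power2_eq_square flip: exp_add)
  ultimately have "(exp (lam * t) * norm (x t - y t))\<^sup>2 \<le> (norm (x 0 - y 0))\<^sup>2"
    by (simp add: power_mult_distrib)
  then have "exp (lam * t) * norm (x t - y t) \<le> norm (x 0 - y 0)"
    by (rule power2_le_imp_le) simp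
  then show ?thesis
    by (simp add: exp_minus field_simps)
qed

lemma has_integral_exp_mult:
  fixes c t :: real
  assumes "c > 0" "t \<ge> 0"
  shows "((\<lambda>s. exp (c * s)) has_integral (exp (c * t) - 1) / c) {0..t}"
proof -
  have "((\<lambda>s. exp (c * s)) has_integral (exp (c * t) / c - exp (c * 0) / c)) {0..t}"
    using assms
    by (intro fundamental_theorem_of_calculus)
      (auto intro!: derivative_eq_intros simp flip: has_real_derivative_iff_has_vector_derivative)
  then show ?thesis
    by (simp add: diff_divide_distrib)
qed

text \<open>In the unknown \<open>exp (- 2 * L * t) *\<^sub>R x t\<close> the Picard operator is a contraction with factor
  \<open>1 / 2\<close> on bounded continuous functions, so one fixed point gives a solution for all times.\<close>

lemma lipschitz_ode_exists:
  fixes g :: "'a::banach \<Rightarrow> 'a"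
  assumes lip: "L-lipschitz_on UNIV g" and "L > 0"
  shows "\<exists>x. x 0 = x0 \<and> (\<forall>t\<ge>0. (x has_vector_derivative g (x t)) (at t within {0..}))"
proof -
  define I where "I y t = integral {0..t} (\<lambda>s. g (exp (2 * L * s) *\<^sub>R apply_bcontfun y s))"
    for y :: "real \<Rightarrow>\<^sub>C 'a" and t
  \<comment> \<open>Bounded continuous functions live on the whole real line; \<open>max 0 t\<close>
    freezes the operator at its value at 0 for negative times.\<close>
  define P where "P y t = exp (- (2 * L * max 0 t)) *\<^sub>R (x0 + I y (max 0 t))" for y t
  have g_cont: "continuous_on UNIV g"
    using lip by (rule lipschitz_on_continuous_on)
  have int_cont: "continuous_on S (\<lambda>s. g (exp (2 * L * s) *\<^sub>R apply_bcontfun y s))" for S y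
    by (rule continuous_on_compose2[OF g_cont]) (auto intro!: continuous_intros)
  have I_deriv: "(I y has_vector_derivative g (exp (2 * L * t) *\<^sub>R apply_bcontfun y t))
      (at t within {0..})" if "t \<ge> 0" for y t
  proof -
    have "(I y has_vector_derivative g (exp (2 * L * t) *\<^sub>R apply_bcontfun y t))
        (at t within {0..t + 1})"
      unfolding I_def using that by (intro integral_has_vector_derivative int_cont) auto
    moreover have "at t within {0..} = at t within {0..t + 1}"
      using that by (intro at_within_nhd[of _ "{t - 1<..<t + 1}"]) auto
    ultimately show ?thesis
      by simp
  qed
  have I_cont: "continuous_on {0..} (I y)" for y
    by (auto simp: continuous_on_eq_continuous_within
        intro!: has_vector_derivative_continuous[OF I_deriv])
  have P_cont: "continuous_on UNIV (P y)" for y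
    unfolding P_def
    by (intro continuous_intros continuous_on_compose2[OF I_cont]) auto
  \<comment> \<open>Used twice: with \<open>C = norm (g 0) + L * norm y\<close> it keeps the Picard
    image bounded, with \<open>C = L * dist y z\<close> it yields the contraction factor, as
    \<open>L / (2 * L) = 1 / 2\<close>.\<close>
  have bound: "norm (integral {0..t} f) \<le> C * (exp (2 * L * t) / (2 * L))"
    if "t \<ge> 0" "C \<ge> 0" "continuous_on {0..t} f"
      "\<And>s. s \<in> {0..t} \<Longrightarrow> norm (f s) \<le> C * exp (2 * L * s)"
    for C t and f :: "real \<Rightarrow> 'a"
  proof -
    have e: "((\<lambda>s. C * exp (2 * L * s)) has_integral C * ((exp (2 * L * t) - 1) / (2 * L))) {0..t}"
      using \<open>L > 0\<close> that(1) by (intro has_integral_mult_right has_integral_exp_mult) auto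
    have "norm (integral {0..t} f) \<le> integral {0..t} (\<lambda>s. C * exp (2 * L * s))"
      using that e
      by (intro integral_norm_bound_integral integrable_continuous_real) (auto intro!: continuous_intros)
    also have "\<dots> = C * ((exp (2 * L * t) - 1) / (2 * L))"
      using e by (rule integral_unique)
    also have "\<dots> \<le> C * (exp (2 * L * t) / (2 * L))"
      using \<open>L > 0\<close> that by (intro mult_left_mono divide_right_mono) auto
    finally show ?thesis .
  qed
  have P_bounded: "norm (P y t) \<le> norm x0 + (norm (g 0) + L * norm y) / (2 * L)" for y t
  proof -
    define \<tau> where "\<tau> = max 0 t"
    have "norm (g (exp (2 * L * s) *\<^sub>R apply_bcontfun y s)) \<le> (norm (g 0) + L * norm y) * exp (2 * L * s)"
      if "s \<in> {0..\<tau>}" for s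
    proof -
      have "norm (g (exp (2 * L * s) *\<^sub>R apply_bcontfun y s))
          \<le> norm (g 0) + dist (g (exp (2 * L * s) *\<^sub>R apply_bcontfun y s)) (g 0)"
        by (simp add: dist_norm norm_triangle_sub)
      also have "\<dots> \<le> norm (g 0) + L * dist (exp (2 * L * s) *\<^sub>R apply_bcontfun y s) 0"
        using lipschitz_onD[OF lip UNIV_I UNIV_I] by (intro add_left_mono)
      also have "\<dots> \<le> norm (g 0) * exp (2 * L * s) + L * (exp (2 * L * s) * norm y)"
      proof (intro add_mono mult_left_mono)
        show "norm (g 0) \<le> norm (g 0) * exp (2 * L * s)"
          using that \<open>L > 0\<close> by (simp add: mult_le_cancel_left1)
        show "dist (exp (2 * L * s) *\<^sub>R apply_bcontfun y s) 0 \<le> exp (2 * L * s) * norm y"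
          by (simp add: norm_bounded)
      qed (use \<open>L > 0\<close> in auto)
      finally show ?thesis
        by (simp add: algebra_simps)
    qed
    then have "norm (I y \<tau>) \<le> (norm (g 0) + L * norm y) * (exp (2 * L * \<tau>) / (2 * L))"
      unfolding I_def using \<open>L > 0\<close>
      by (intro bound int_cont) (auto simp: \<tau>_def)
    then have "norm (P y t) \<le> exp (- (2 * L * \<tau>)) *
        (norm x0 + (norm (g 0) + L * norm y) * (exp (2 * L * \<tau>) / (2 * L)))"
      unfolding P_def \<tau>_def[symmetric] by (auto intro: order_trans[OF norm_triangle_ineq])
    also have "\<dots> = exp (- (2 * L * \<tau>)) * norm x0 + (norm (g 0) + L * norm y) / (2 * L)"
      using \<open>L > 0\<close> by (simp add: exp_minus field_simps)
    also have "exp (- (2 * L * \<tau>)) * norm x0 \<le> 1 * norm x0"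
      using \<open>L > 0\<close> by (intro mult_right_mono) (auto simp: \<tau>_def)
    finally show ?thesis
      by simp
  qed
  have P_bcontfun: "P y \<in> bcontfun" for y
    by (rule bcontfun_normI[OF P_cont P_bounded])
  have "\<exists>!y. Bcontfun (P y) = y"
  proof (rule banach_fix_type[of "1 / 2"], simp_all, intro allI)
    fix y z
    show "dist (Bcontfun (P y)) (Bcontfun (P z)) * 2 \<le> dist y z"
    proof -
      have "dist (apply_bcontfun (Bcontfun (P y)) t) (apply_bcontfun (Bcontfun (P z)) t)
          \<le> dist y z / 2" for t
      proof -
        define \<tau> where "\<tau> = max 0 t"
        have "\<tau> \<ge> 0"
          by (simp add: \<tau>_def)
        have "norm (g (exp (2 * L * s) *\<^sub>R apply_bcontfun y s) - g (exp (2 * L * s) *\<^sub>R apply_bcontfun z s))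
            \<le> (L * dist y z) * exp (2 * L * s)" for s
        proof -
          have "norm (g (exp (2 * L * s) *\<^sub>R apply_bcontfun y s) - g (exp (2 * L * s) *\<^sub>R apply_bcontfun z s))
             \<le> L * (exp (2 * L * s) * dist (apply_bcontfun y s) (apply_bcontfun z s))"
            using lipschitz_onD[OF lip, of "exp (2 * L * s) *\<^sub>R apply_bcontfun y s"
                "exp (2 * L * s) *\<^sub>R apply_bcontfun z s"]
            by (simp add: dist_norm flip: scaleR_diff_right)
          also have "\<dots> \<le> L * (exp (2 * L * s) * dist y z)"
            using \<open>L > 0\<close> by (intro mult_left_mono dist_bounded) auto
          finally show ?thesis
            by (simp add: mult_ac)
        qed
        then have "norm (I y \<tau> - I z \<tau>) \<le> (L * dist y z) * (exp (2 * L * \<tau>) / (2 * L))"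
          unfolding I_def using \<open>L > 0\<close> \<open>\<tau> \<ge> 0\<close>
          by (subst integral_diff[symmetric])
            (intro bound integrable_continuous_real int_cont continuous_on_diff | simp)+
        then have "norm (P y t - P z t) \<le> exp (- (2 * L * \<tau>)) * ((L * dist y z) * (exp (2 * L * \<tau>) / (2 * L)))"
          unfolding P_def \<tau>_def[symmetric] by (simp flip: scaleR_diff_right)
        also have "\<dots> = dist y z / 2"
          using \<open>L > 0\<close> by (simp add: exp_minus field_simps)
        finally show ?thesis
          using P_bcontfun by (simp add: Bcontfun_inverse dist_norm)
      qed
      then have "dist (Bcontfun (P y)) (Bcontfun (P z)) \<le> dist y z / 2"
        by (rule dist_bound)
      then show ?thesis
        by simp
    qed
  qed
  then obtain y where "Bcontfun (P y) = y"
    by auto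
  then have y: "P y t = apply_bcontfun y t" for t
    by (metis Bcontfun_inverse P_bcontfun)
  define x where "x t = x0 + I y t" for t
  have "x t = exp (2 * L * t) *\<^sub>R apply_bcontfun y t" if "t \<ge> 0" for t
    using that y[of t] by (auto simp: P_def x_def exp_minus simp flip: y)
  then have "(x has_vector_derivative g (x t)) (at t within {0..})" if "t \<ge> 0" for t
    using I_deriv[OF that, of y] that unfolding x_def
    by (auto intro!: derivative_eq_intros)
  moreover have "x 0 = x0"
    by (simp add: x_def I_def)
  ultimately show ?thesis
    by blast
qed

text \<open>If \<open>x + h *\<^sub>R V x\<close> stays in the polytope, then the equation \<open>x' = V x\<close> reads \<open>x' = (G x - x) / h\<close>
  with \<open>G\<close> a self-map of the polytope: the right-hand side always pulls towards the polytope, also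
  after it is extended to the whole space by composing \<open>G\<close> with the nearest-point projection.\<close>

lemma polytope_flow:
  fixes V :: "'a::euclidean_space \<Rightarrow> 'a" and H :: "('a \<times> real) set"
  assumes K_def: "K = {x. \<forall>(a, c)\<in>H. c \<le> a \<bullet> x}"
    and "finite H" and "compact K" and "x0 \<in> K"
    and lip: "L-lipschitz_on K V" and "\<eta> > 0"
    and inward: "\<And>x a c. x \<in> K \<Longrightarrow> (a, c) \<in> H \<Longrightarrow> a \<bullet> x \<le> c + \<eta> \<Longrightarrow> 0 \<le> a \<bullet> V x"
  shows polytope_flow_zero: "\<exists>x\<in>K. V x = 0"
    and polytope_flow_exists: "\<exists>x. x 0 = x0 \<and>
      (\<forall>t\<ge>0. x t \<in> K \<and> (x has_vector_derivative V (x t)) (at t within {0..}))"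
proof -
  have V_cont: "continuous_on K V"
    using lip by (rule lipschitz_on_continuous_on)
  have "K = (\<Inter>p\<in>H. {x. snd p \<le> fst p \<bullet> x})"
    unfolding K_def by fastforce
  then have "convex K"
    by (auto intro!: convex_INT convex_halfspace_ge simp: inner_commute)
  have "closed K"
    using \<open>compact K\<close> by (rule compact_imp_closed)
  have "bounded (V ` K)"
    using compact_continuous_image[OF V_cont \<open>compact K\<close>] by (rule compact_imp_bounded)
  then obtain M where M: "M > 0" "\<And>x. x \<in> K \<Longrightarrow> norm (V x) \<le> M"
    by (auto simp: bounded_pos)
  have "bounded (fst ` H)"
    using \<open>finite H\<close> by (intro finite_imp_bounded) auto
  then obtain R where R: "R > 0" "\<And>a c. (a, c) \<in> H \<Longrightarrow> norm a \<le> R"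
    by (force simp: bounded_pos)
  \<comment> \<open>A step of length \<open>h\<close> changes \<open>a \<bullet> x\<close> by at
    most \<open>h * R * M = \<eta>\<close>. Constraints with slack above \<open>\<eta>\<close>
    therefore survive the step, and the others are covered by inwardness.\<close>
  define h where "h = \<eta> / (R * M)"
  have "h > 0"
    using M R \<open>\<eta> > 0\<close> by (simp add: h_def)
  define G where "G x = x + h *\<^sub>R V x" for x
  have G: "G x \<in> K" if x: "x \<in> K" for x
  proof -
    have "c \<le> a \<bullet> G x" if ac: "(a, c) \<in> H" for a c
    proof (cases "a \<bullet> x \<le> c + \<eta>")
      case True
      then have "0 \<le> a \<bullet> V x"
        using inward x ac by blast
      moreover have "c \<le> a \<bullet> x"
        using x ac by (auto simp: K_def)
      ultimately show ?thesis
        using \<open>h > 0\<close> by (simp add: G_def inner_add_right add_increasing2)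
    next
      case False
      have "\<bar>a \<bullet> V x\<bar> \<le> norm a * norm (V x)"
        by (rule Cauchy_Schwarz_ineq2)
      also have "\<dots> \<le> R * M"
        using M R x ac by (intro mult_mono) (auto intro: less_imp_le)
      finally have "- (R * M) \<le> a \<bullet> V x"
        by simp
      then have "h * - (R * M) \<le> h * (a \<bullet> V x)"
        using \<open>h > 0\<close> by (intro mult_left_mono) auto
      moreover have "h * - (R * M) = - \<eta>"
        using M R by (simp add: h_def)
      ultimately show ?thesis
        using False by (simp add: G_def inner_add_right)
    qed
    then show ?thesis
      by (auto simp: K_def)
  qed
  have "continuous_on K G"
    unfolding G_def by (intro continuous_intros V_cont)
  then obtain z where "z \<in> K" "G z = z"
    using brouwer[OF \<open>compact K\<close> \<open>convex K\<close>] G \<open>x0 \<in> K\<close> by blast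
  then show "\<exists>x\<in>K. V x = 0"
    using \<open>h > 0\<close> by (intro bexI[of _ z]) (auto simp: G_def)
  define p where "p = closest_point K"
  have p: "p x \<in> K" for x
    unfolding p_def using \<open>closed K\<close> \<open>x0 \<in> K\<close> by (intro closest_point_in_set) auto
  have p_lip: "1-lipschitz_on UNIV p"
    unfolding p_def using \<open>closed K\<close> \<open>convex K\<close> \<open>x0 \<in> K\<close>
    by (intro lipschitz_onI) (auto intro!: closest_point_lipschitz)
  define g where "g x = (1 / h) *\<^sub>R (G (p x) - x)" for x
  have "L \<ge> 0"
    using lip by (rule lipschitz_on_nonneg)
  have "(1 + \<bar>h\<bar> * L)-lipschitz_on K G"
    unfolding G_def by (intro lipschitz_intros lip)
  then have "((1 + \<bar>h\<bar> * L) * 1)-lipschitz_on UNIV (\<lambda>x. G (p x))"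
    using p by (intro lipschitz_on_compose2[OF p_lip]) (auto elim: lipschitz_on_subset)
  then have "(\<bar>1 / h\<bar> * ((1 + \<bar>h\<bar> * L) * 1 + 1))-lipschitz_on UNIV g"
    unfolding g_def by (intro lipschitz_intros)
  moreover have "\<bar>1 / h\<bar> * ((1 + \<bar>h\<bar> * L) * 1 + 1) > 0"
    using \<open>h > 0\<close> \<open>L \<ge> 0\<close> by (intro mult_pos_pos add_nonneg_pos) auto
  ultimately obtain x where x0: "x 0 = x0"
    and x: "\<And>t. t \<ge> 0 \<Longrightarrow> (x has_vector_derivative g (x t)) (at t within {0..})"
    using lipschitz_ode_exists by metis
  have x_K: "x t \<in> K" if "t \<ge> 0" for t
  proof -
    have "c \<le> a \<bullet> x t" if ac: "(a, c) \<in> H" for a c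
    proof -
      \<comment> \<open>\<open>exp (t / h)\<close> is the integrating factor of
        \<open>x' = (G (p x) - x) / h\<close>; the remaining derivative is nonnegative because
        \<open>G (p x)\<close> satisfies the constraint.\<close>
      let ?f = "\<lambda>t. exp (t / h) * (a \<bullet> x t - c)"
      have "?f 0 \<le> ?f t"
      proof (rule halfline_deriv_nonneg_imp_le[of ?f "\<lambda>t. exp (t / h) / h * (a \<bullet> G (p (x t)) - c)"])
        fix s :: real assume s: "s \<ge> 0"
        have "((\<lambda>t. a \<bullet> x t) has_real_derivative a \<bullet> g (x s)) (at s within {0..})"
          using bounded_linear.has_vector_derivative[OF bounded_linear_inner_right x[OF s]]
          by (simp add: has_real_derivative_iff_has_vector_derivative)
        then show "(?f has_real_derivative exp (s / h) / h * (a \<bullet> G (p (x s)) - c)) (at s within {0..})"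
          using \<open>h > 0\<close>
          by (auto intro!: derivative_eq_intros simp: g_def inner_diff_right field_simps)
        show "exp (s / h) / h * (a \<bullet> G (p (x s)) - c) \<ge> 0"
          using G[OF p, of "x s"] ac \<open>h > 0\<close> by (auto simp: K_def)
      qed fact
      moreover have "c \<le> a \<bullet> x 0"
        using \<open>x0 \<in> K\<close> ac x0 by (auto simp: K_def)
      ultimately have "0 \<le> ?f t"
        by simp
      then show ?thesis
        by (simp add: zero_le_mult_iff)
    qed
    then show ?thesis
      by (auto simp: K_def)
  qed
  have "g (x t) = V (x t)" if "t \<ge> 0" for t
    using x_K[OF that] \<open>h > 0\<close> by (simp add: g_def p_def G_def closest_point_self)
  then show "\<exists>x. x 0 = x0 \<and>
      (\<forall>t\<ge>0. x t \<in> K \<and> (x has_vector_derivative V (x t)) (at t within {0..}))"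
    using x0 x x_K by metis
qed

section \<open>Right-angled hexagons\<close>

text \<open>\<open>hexagon_side a b d\<close> is the side opposite to the side of length \<open>arcosh a\<close>, where \<open>a\<close>, \<open>b\<close>, \<open>d\<close>
  are the hyperbolic cosines of three pairwise non-adjacent sides. An edge with \<open>cosh (l / 2) = exp s\<close>
  has \<open>cosh l = edge_cosh s\<close>.\<close>

definition hexagon_side :: "real \<Rightarrow> real \<Rightarrow> real \<Rightarrow> real" where
  "hexagon_side a b d = arcosh ((a + b * d) / (sqrt (b\<^sup>2 - 1) * sqrt (d\<^sup>2 - 1)))"

text \<open>Minus the determinant of the Gram matrix with diagonal 1 and off-diagonal entries
  \<open>- a\<close>, \<open>- b\<close>, \<open>- d\<close>. It is symmetric in its arguments, so
  the derivatives of all three sides share one denominator.\<close>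

definition hexagon_disc :: "real \<Rightarrow> real \<Rightarrow> real \<Rightarrow> real" where
  "hexagon_disc a b d = a\<^sup>2 + b\<^sup>2 + d\<^sup>2 + 2 * a * b * d - 1"

definition edge_cosh :: "real \<Rightarrow> real" where
  "edge_cosh s = 2 * exp (2 * s) - 1"

lemma edge_cosh_mono: "s \<le> t \<Longrightarrow> edge_cosh s \<le> edge_cosh t"
  by (simp add: edge_cosh_def)

lemma edge_cosh_gt_1: "s > 0 \<Longrightarrow> edge_cosh s > 1"
  by (simp add: edge_cosh_def)

lemma edge_cosh_bounds:
  assumes "s > 0"
  shows "exp (2 * s) \<le> edge_cosh s" "edge_cosh s \<le> 2 * exp (2 * s)"
  using assms one_le_exp_iff[of "2 * s"] unfolding edge_cosh_def by linarith+

lemma hexagon_disc_rotate: "hexagon_disc b d a = hexagon_disc a b d"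
  by (simp add: hexagon_disc_def algebra_simps)

lemma hexagon_side_commute: "hexagon_side a b d = hexagon_side a d b"
  by (simp add: hexagon_side_def mult_ac)

lemma hexagon_disc_ge_4:
  assumes "a \<ge> 1" "b \<ge> 1" "d \<ge> 1"
  shows "hexagon_disc a b d \<ge> 4"
proof -
  have "1 \<le> a * b * d"
    using assms mult_mono[of 1 "a * b" 1 d] mult_mono[of 1 a 1 b] by simp
  moreover have "1 \<le> a\<^sup>2" "1 \<le> b\<^sup>2" "1 \<le> d\<^sup>2"
    using assms by (auto intro: one_le_power)
  ultimately show ?thesis
    by (simp add: hexagon_disc_def)
qed

lemma hexagon_disc_mono:
  assumes "1 \<le> a" "a \<le> C" "1 \<le> b" "b \<le> C" "1 \<le> d" "d \<le> C"
  shows "hexagon_disc a b d \<le> hexagon_disc C C C"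
proof -
  have "a * b * d \<le> C * C * C"
    using assms by (intro mult_mono) auto
  moreover have "a\<^sup>2 \<le> C\<^sup>2" "b\<^sup>2 \<le> C\<^sup>2" "d\<^sup>2 \<le> C\<^sup>2"
    using assms by (auto intro!: power_mono)
  ultimately show ?thesis
    by (simp add: hexagon_disc_def)
qed

text \<open>Both parts come from the identity \<open>(a + b * d)\<^sup>2 - (b\<^sup>2 - 1) *
  (d\<^sup>2 - 1) = hexagon_disc a b d\<close>. Since \<open>u\<close> is the hyperbolic cosine of
  the side, the second part computes its hyperbolic sine.\<close>

lemma hexagon_side_arg:
  assumes "a > 1" "b > 1" "d > 1"
  defines "u \<equiv> (a + b * d) / (sqrt (b\<^sup>2 - 1) * sqrt (d\<^sup>2 - 1))"
  shows "u > 1" and "sqrt (u\<^sup>2 - 1) = sqrt (hexagon_disc a b d) / (sqrt (b\<^sup>2 - 1) * sqrt (d\<^sup>2 - 1))"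
proof -
  define r where "r = sqrt (b\<^sup>2 - 1) * sqrt (d\<^sup>2 - 1)"
  have b: "b\<^sup>2 > 1" and d: "d\<^sup>2 > 1"
    using assms by (auto intro: one_less_power)
  have r: "r > 0"
    using b d by (simp add: r_def)
  have r2: "r\<^sup>2 = (b\<^sup>2 - 1) * (d\<^sup>2 - 1)"
    using b d by (simp add: r_def power_mult_distrib)
  have eq: "(a + b * d)\<^sup>2 - r\<^sup>2 = hexagon_disc a b d"
    unfolding r2 hexagon_disc_def by (simp add: power2_eq_square algebra_simps)
  have "hexagon_disc a b d \<ge> 4"
    using assms by (intro hexagon_disc_ge_4) auto
  then have "r\<^sup>2 < (a + b * d)\<^sup>2"
    using eq by linarith
  then have "r < a + b * d"
    using assms by (intro power2_less_imp_less[of r]) auto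
  then show "u > 1"
    using r by (simp add: u_def r_def[symmetric])
  have "u\<^sup>2 - 1 = hexagon_disc a b d / r\<^sup>2"
    using r by (simp add: u_def r_def[symmetric] power_divide diff_divide_distrib flip: eq)
  then show "sqrt (u\<^sup>2 - 1) = sqrt (hexagon_disc a b d) / (sqrt (b\<^sup>2 - 1) * sqrt (d\<^sup>2 - 1))"
    unfolding r_def[symmetric] using r by (simp add: real_sqrt_divide)
qed

text \<open>The denominator \<open>p * q\<close> in the derivative of the argument \<open>u\<close>
  cancels against the one in \<open>sqrt (u\<^sup>2 - 1)\<close>, so that only the square root of
  the symmetric discriminant is left.\<close>

lemma hexagon_side_deriv:
  fixes a b d :: "real \<Rightarrow> real"
  assumes "a t > 1" "b t > 1" "d t > 1"
    and "(a has_real_derivative a') (at t)"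
      "(b has_real_derivative b') (at t)" "(d has_real_derivative d') (at t)"
  shows "((\<lambda>t. hexagon_side (a t) (b t) (d t)) has_real_derivative
    (a' - (d t + a t * b t) / ((b t)\<^sup>2 - 1) * b' - (b t + a t * d t) / ((d t)\<^sup>2 - 1) * d')
      / sqrt (hexagon_disc (a t) (b t) (d t))) (at t)"
proof -
  define u where "u t = (a t + b t * d t) / (sqrt ((b t)\<^sup>2 - 1) * sqrt ((d t)\<^sup>2 - 1))" for t
  define p q where "p = sqrt ((b t)\<^sup>2 - 1)" and "q = sqrt ((d t)\<^sup>2 - 1)"
  have b: "(b t)\<^sup>2 > 1" and d: "(d t)\<^sup>2 > 1"
    using assms by (auto intro: one_less_power)
  have pq: "p > 0" "q > 0" "p\<^sup>2 = (b t)\<^sup>2 - 1" "q\<^sup>2 = (d t)\<^sup>2 - 1"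
    using b d by (auto simp: p_def q_def)
  define N where "N = a' - (d t + a t * b t) / p\<^sup>2 * b' - (b t + a t * d t) / q\<^sup>2 * d'"
  have sq: "((\<lambda>t. sqrt ((f t)\<^sup>2 - 1)) has_real_derivative f t * f' / sqrt ((f t)\<^sup>2 - 1)) (at t)"
    if "(f has_real_derivative f') (at t)" "(f t)\<^sup>2 > 1" for f f'
  proof -
    have "((\<lambda>t. (f t)\<^sup>2 - 1) has_real_derivative 2 * f t * f') (at t)"
      using that(1) by (auto intro!: derivative_eq_intros)
    then have "((\<lambda>t. sqrt ((f t)\<^sup>2 - 1)) has_real_derivative
        inverse (sqrt ((f t)\<^sup>2 - 1)) / 2 * (2 * f t * f')) (at t)"
      using that(2) by (intro DERIV_chain2[where f = sqrt] DERIV_real_sqrt) auto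
    then show ?thesis
      by (rule DERIV_cong) (simp add: field_simps)
  qed
  have "(u has_real_derivative
      ((a' + (b' * d t + b t * d')) * (p * q) -
        (a t + b t * d t) * (b t * b' / p * q + p * (d t * d' / q))) / (p * q)\<^sup>2) (at t)"
  proof -
    have "sqrt ((b t)\<^sup>2 - 1) * sqrt ((d t)\<^sup>2 - 1) \<noteq> 0"
      using b d by simp
    from DERIV_divide[OF DERIV_add[OF assms(4) DERIV_mult[OF assms(5,6)]]
        DERIV_mult[OF sq[OF assms(5) b] sq[OF assms(6) d]] this, folded u_def p_def q_def]
    show ?thesis
      by (rule DERIV_cong) (simp add: power2_eq_square algebra_simps)
  qed
  moreover have "((a' + (b' * d t + b t * d')) * (p * q) -
        (a t + b t * d t) * (b t * b' / p * q + p * (d t * d' / q))) / (p * q)\<^sup>2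
      = N / (p * q)" (is "?l = ?r")
  proof -
    have bb: "(b t)\<^sup>2 = p\<^sup>2 + 1" "(d t)\<^sup>2 = q\<^sup>2 + 1"
      using pq by auto
    have "?l = (a' + (d t - (a t * b t + (b t)\<^sup>2 * d t) / p\<^sup>2) * b'
        + (b t - (a t * d t + b t * (d t)\<^sup>2) / q\<^sup>2) * d') / (p * q)"
      using pq(1,2) by (simp add: power2_eq_square field_simps)
    also have "d t - (a t * b t + (b t)\<^sup>2 * d t) / p\<^sup>2 = - ((d t + a t * b t) / p\<^sup>2)"
      unfolding bb using pq(1,2) by (simp add: field_simps)
    also have "b t - (a t * d t + b t * (d t)\<^sup>2) / q\<^sup>2 = - ((b t + a t * d t) / q\<^sup>2)"
      unfolding bb using pq(1,2) by (simp add: field_simps)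
    finally show ?thesis
      by (simp add: N_def)
  qed
  ultimately have u': "(u has_real_derivative N / (p * q)) (at t)"
    by simp
  have u: "u t > 1" "sqrt ((u t)\<^sup>2 - 1) = sqrt (hexagon_disc (a t) (b t) (d t)) / (p * q)"
    using hexagon_side_arg[OF assms(1-3)] by (auto simp: u_def p_def q_def)
  have "((\<lambda>t. arcosh (u t)) has_real_derivative 1 / sqrt ((u t)\<^sup>2 - 1) * (N / (p * q))) (at t)"
    by (rule DERIV_chain2[OF arcosh_real_has_field_derivative[OF u(1)] u'])
  moreover have "1 / sqrt ((u t)\<^sup>2 - 1) * (N / (p * q)) = N / sqrt (hexagon_disc (a t) (b t) (d t))"
    unfolding u(2) using pq(1,2) by simp
  ultimately show ?thesis
    unfolding N_def pq u_def hexagon_side_def by (simp only:)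
qed

text \<open>The numerator of the derivative of a side when the three edge weights change at rates
  \<open>p\<close>, \<open>q\<close>, \<open>r\<close>. As \<open>edge_cosh\<close> has derivative
  \<open>2 * (edge_cosh s + 1)\<close>, one factor of \<open>b\<^sup>2 - 1\<close> and of
  \<open>d\<^sup>2 - 1\<close> cancels; the common 2 is left outside.\<close>

definition hexagon_slope :: "real \<Rightarrow> real \<Rightarrow> real \<Rightarrow> real \<Rightarrow> real \<Rightarrow> real \<Rightarrow> real" where
  "hexagon_slope a b d p q r =
     (a + 1) * p - (d + a * b) / (b - 1) * q - (b + a * d) / (d - 1) * r"

lemma hexagon_side_edge_deriv:
  assumes "s1 t > 0" "s2 t > 0" "s3 t > 0"
    and d: "(s1 has_real_derivative p) (at t)" "(s2 has_real_derivative q) (at t)"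
      "(s3 has_real_derivative r) (at t)"
  defines "a \<equiv> edge_cosh (s1 t)" and "b \<equiv> edge_cosh (s2 t)" and "d \<equiv> edge_cosh (s3 t)"
  shows "((\<lambda>t. hexagon_side (edge_cosh (s1 t)) (edge_cosh (s2 t)) (edge_cosh (s3 t)))
    has_real_derivative 2 / sqrt (hexagon_disc a b d) * hexagon_slope a b d p q r) (at t)"
proof -
  have e: "((\<lambda>t. edge_cosh (s t)) has_real_derivative 2 * (edge_cosh (s t) + 1) * s') (at t)"
    if "(s has_real_derivative s') (at t)" for s s'
    unfolding edge_cosh_def using that by (auto intro!: derivative_eq_intros)
  have gt: "a > 1" "b > 1" "d > 1"
    using assms by (auto simp: edge_cosh_gt_1)
  have *: "z / (y\<^sup>2 - 1) * (2 * (y + 1) * s') = 2 * (z / (y - 1) * s')" if "y > 1" for z y s' :: real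
  proof -
    have "y\<^sup>2 - 1 = (y - 1) * (y + 1)"
      by (simp add: power2_eq_square algebra_simps)
    then show ?thesis
      using that by (simp only:) (simp add: divide_simps)
  qed
  have "((\<lambda>t. hexagon_side (edge_cosh (s1 t)) (edge_cosh (s2 t)) (edge_cosh (s3 t)))
    has_real_derivative (2 * (a + 1) * p - (d + a * b) / (b\<^sup>2 - 1) * (2 * (b + 1) * q)
      - (b + a * d) / (d\<^sup>2 - 1) * (2 * (d + 1) * r)) / sqrt (hexagon_disc a b d)) (at t)"
    unfolding a_def b_def d_def
    using gt by (intro hexagon_side_deriv e assms) (auto simp: a_def b_def d_def)
  also have "(2 * (a + 1) * p - (d + a * b) / (b\<^sup>2 - 1) * (2 * (b + 1) * q)
      - (b + a * d) / (d\<^sup>2 - 1) * (2 * (d + 1) * r)) = 2 * hexagon_slope a b d p q r"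
    unfolding *[OF gt(2)] *[OF gt(3)] by (simp add: hexagon_slope_def algebra_simps)
  finally show ?thesis
    by simp
qed

text \<open>Up to a positive factor, the Jacobian of the three sides with respect to the conformal factors
  is minus the form \<open>\<Sum>a\<^sub>k (d\<^sub>i + d\<^sub>j)\<^sup>2 + \<Sum>(d\<^sub>i - d\<^sub>j)\<^sup>2 + 2 \<Sum>x\<^sub>i d\<^sub>i\<^sup>2\<close>
  with \<open>x\<^sub>i = cosh l\<^sub>i - 1\<close> and \<open>a\<^sub>k = (x\<^sub>i + x\<^sub>j + 2) / x\<^sub>k\<close>.\<close>

lemma hexagon_slope_quadratic_form:
  assumes "c1 > 1" "c2 > 1" "c3 > 1"
  shows "d1 * hexagon_slope c1 c2 c3 (d2 + d3) (d3 + d1) (d1 + d2)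
      + d2 * hexagon_slope c2 c3 c1 (d3 + d1) (d1 + d2) (d2 + d3)
      + d3 * hexagon_slope c3 c1 c2 (d1 + d2) (d2 + d3) (d3 + d1)
    \<le> - 2 * ((c1 - 1) * d1\<^sup>2 + (c2 - 1) * d2\<^sup>2 + (c3 - 1) * d3\<^sup>2)"
    (is "?l \<le> _")
proof -
  define x1 x2 x3 where "x1 = c1 - 1" and "x2 = c2 - 1" and "x3 = c3 - 1"
  have x: "x1 > 0" "x2 > 0" "x3 > 0"
    using assms by (auto simp: x1_def x2_def x3_def)
  have c: "c1 = x1 + 1" "c2 = x2 + 1" "c3 = x3 + 1"
    by (auto simp: x1_def x2_def x3_def)
  define a1 a2 a3 where "a1 = (x2 + x3 + 2) / x1" and "a2 = (x3 + x1 + 2) / x2"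
    and "a3 = (x1 + x2 + 2) / x3"
  have a: "a1 > 0" "a2 > 0" "a3 > 0"
    using x by (auto simp: a1_def a2_def a3_def)
  have s1: "hexagon_slope c1 c2 c3 p q r = (x1 + 2) * p - (x1 + 1 + a2) * q - (x1 + 1 + a3) * r"
    and s2: "hexagon_slope c2 c3 c1 p q r = (x2 + 2) * p - (x2 + 1 + a3) * q - (x2 + 1 + a1) * r"
    and s3: "hexagon_slope c3 c1 c2 p q r = (x3 + 2) * p - (x3 + 1 + a1) * q - (x3 + 1 + a2) * r"
    for p q r
    using x unfolding hexagon_slope_def c a1_def a2_def a3_def
    by (simp_all add: field_simps)
  have "?l = - (a1 * (d2 + d3)\<^sup>2 + a2 * (d3 + d1)\<^sup>2 + a3 * (d1 + d2)\<^sup>2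
      + (d1 - d2)\<^sup>2 + (d2 - d3)\<^sup>2 + (d3 - d1)\<^sup>2 + 2 * (x1 * d1\<^sup>2 + x2 * d2\<^sup>2 + x3 * d3\<^sup>2))"
    unfolding s1 s2 s3 by (simp add: power2_eq_square algebra_simps)
  also have "\<dots> \<le> - 2 * (x1 * d1\<^sup>2 + x2 * d2\<^sup>2 + x3 * d3\<^sup>2)"
  proof -
    have "0 \<le> a1 * (d2 + d3)\<^sup>2" "0 \<le> a2 * (d3 + d1)\<^sup>2" "0 \<le> a3 * (d1 + d2)\<^sup>2"
      "0 \<le> (d1 - d2)\<^sup>2" "0 \<le> (d2 - d3)\<^sup>2" "0 \<le> (d3 - d1)\<^sup>2"
      using a by auto
    then show ?thesis
      by linarith
  qed
  finally show ?thesis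
    by (simp add: x1_def x2_def x3_def)
qed

section \<open>Uniform monotonicity and Lipschitz bounds for one hexagon\<close>

lemma segment_bounds:
  fixes u v t :: real
  assumes "u \<in> {\<delta>..R}" "v \<in> {\<delta>..R}" "0 < t" "t < 1"
  shows "v + t * (u - v) \<in> {\<delta>..R}"
proof -
  have "(1 - t) * v + t * u \<in> {\<delta>..R}"
    using convexD[of "{\<delta>..R}" v u "1 - t" t] assms by (simp add: convex_real_interval)
  then show ?thesis
    by (simp add: algebra_simps)
qed

text \<open>The 8 is a product of three factors 2: from the derivative of a side, from the quadratic
  form, and from \<open>edge_cosh \<delta> - 1 = 2 * (exp (2 * \<delta>) - 1)\<close>. The
  denominator is the largest discriminant root over weights up to \<open>R\<close>.\<close>

definition monotonicity_const :: "real \<Rightarrow> real \<Rightarrow> real" where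
  "monotonicity_const \<delta> R =
     8 * (exp (2 * \<delta>) - 1) / sqrt (hexagon_disc (edge_cosh R) (edge_cosh R) (edge_cosh R))"

text \<open>The mean value theorem is applied to the sum of the sides weighted by the fixed
  differences \<open>d1\<close>, \<open>d2\<close>, \<open>d3\<close>, along the segment from
  \<open>y\<close> to \<open>x\<close>. Its derivative is the quadratic form of the Jacobian at an
  intermediate point, where the edge weights, being affine, still lie in
  \<open>{\<delta>..R}\<close>.\<close>

lemma hexagon_strongly_monotone:
  fixes x1 x2 x3 y1 y2 y3 k1 k2 k3 :: real
  defines "s1 \<equiv> x2 + x3 + k1" and "s2 \<equiv> x3 + x1 + k2" and "s3 \<equiv> x1 + x2 + k3"
    and "r1 \<equiv> y2 + y3 + k1" and "r2 \<equiv> y3 + y1 + k2" and "r3 \<equiv> y1 + y2 + k3"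
  assumes "\<delta> > 0"
    and s: "s1 \<in> {\<delta>..R}" "s2 \<in> {\<delta>..R}" "s3 \<in> {\<delta>..R}"
    and r: "r1 \<in> {\<delta>..R}" "r2 \<in> {\<delta>..R}" "r3 \<in> {\<delta>..R}"
  shows "(x1 - y1) * (hexagon_side (edge_cosh s1) (edge_cosh s2) (edge_cosh s3)
        - hexagon_side (edge_cosh r1) (edge_cosh r2) (edge_cosh r3))
      + (x2 - y2) * (hexagon_side (edge_cosh s2) (edge_cosh s3) (edge_cosh s1)
        - hexagon_side (edge_cosh r2) (edge_cosh r3) (edge_cosh r1))
      + (x3 - y3) * (hexagon_side (edge_cosh s3) (edge_cosh s1) (edge_cosh s2)
        - hexagon_side (edge_cosh r3) (edge_cosh r1) (edge_cosh r2))
    \<le> - monotonicity_const \<delta> R * ((x1 - y1)\<^sup>2 + (x2 - y2)\<^sup>2 + (x3 - y3)\<^sup>2)"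
proof -
  define d1 d2 d3 where "d1 = x1 - y1" and "d2 = x2 - y2" and "d3 = x3 - y3"
  define g1 g2 g3 where "g1 t = r1 + t * (s1 - r1)" and "g2 t = r2 + t * (s2 - r2)"
    and "g3 t = r3 + t * (s3 - r3)" for t
  define c1 c2 c3 where "c1 t = edge_cosh (g1 t)" and "c2 t = edge_cosh (g2 t)"
    and "c3 t = edge_cosh (g3 t)" for t
  have g: "g1 t \<in> {\<delta>..R}" "g2 t \<in> {\<delta>..R}" "g3 t \<in> {\<delta>..R}" if "t \<in> {0..1}" for t
    using that s r segment_bounds[OF s(1) r(1), of t] segment_bounds[OF s(2) r(2), of t]
      segment_bounds[OF s(3) r(3), of t]
    unfolding g1_def g2_def g3_def by (cases "t = 0 \<or> t = 1"; force)+
  have slopes: "s1 - r1 = d2 + d3" "s2 - r2 = d3 + d1" "s3 - r3 = d1 + d2"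
    by (simp_all add: s1_def s2_def s3_def r1_def r2_def r3_def d1_def d2_def d3_def)
  have g': "(g1 has_real_derivative d2 + d3) (at t)" "(g2 has_real_derivative d3 + d1) (at t)"
    "(g3 has_real_derivative d1 + d2) (at t)" for t
    unfolding g1_def g2_def g3_def slopes by (auto intro!: derivative_eq_intros)
  define \<phi> where "\<phi> t = d1 * hexagon_side (c1 t) (c2 t) (c3 t)
    + d2 * hexagon_side (c2 t) (c3 t) (c1 t) + d3 * hexagon_side (c3 t) (c1 t) (c2 t)" for t
  define D where "D t = sqrt (hexagon_disc (c1 t) (c2 t) (c3 t))" for t
  define Q where "Q t = d1 * hexagon_slope (c1 t) (c2 t) (c3 t) (d2 + d3) (d3 + d1) (d1 + d2)
      + d2 * hexagon_slope (c2 t) (c3 t) (c1 t) (d3 + d1) (d1 + d2) (d2 + d3)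
      + d3 * hexagon_slope (c3 t) (c1 t) (c2 t) (d1 + d2) (d2 + d3) (d3 + d1)" for t
  have deriv: "(\<phi> has_real_derivative 2 / D t * Q t) (at t)" if t: "t \<in> {0..1}" for t
  proof -
    have pos: "g1 t > 0" "g2 t > 0" "g3 t > 0"
      using g[OF t] \<open>\<delta> > 0\<close> by auto
    note h = hexagon_side_edge_deriv[of g1 t g2 g3, OF pos g']
      hexagon_side_edge_deriv[of g2 t g3 g1, OF pos(2,3,1) g'(2,3,1)]
      hexagon_side_edge_deriv[of g3 t g1 g2, OF pos(3,1,2) g'(3,1,2)]
    have D: "sqrt (hexagon_disc (c2 t) (c3 t) (c1 t)) = D t"
      "sqrt (hexagon_disc (c3 t) (c1 t) (c2 t)) = D t"
      unfolding D_def by (metis hexagon_disc_rotate)+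
    note h' = h[folded c1_def c2_def c3_def, unfolded D, folded D_def]
    show ?thesis
      unfolding \<phi>_def
      by (rule derivative_eq_intros h' refl)+ (simp add: Q_def algebra_simps)
  qed
  have "\<exists>\<xi>::real. 0 < \<xi> \<and> \<xi> < 1 \<and> \<phi> 1 - \<phi> 0 = (1 - 0) * (2 / D \<xi> * Q \<xi>)"
    using deriv by (intro MVT2) auto
  then obtain \<xi> where \<xi>: "\<xi> \<in> {0..1}" "\<phi> 1 - \<phi> 0 = 2 / D \<xi> * Q \<xi>"
    by (metis atLeastAtMost_iff less_imp_le diff_zero mult_1)
  define C where "C = edge_cosh R"
  have c_ge: "edge_cosh \<delta> \<le> c1 \<xi>" "edge_cosh \<delta> \<le> c2 \<xi>" "edge_cosh \<delta> \<le> c3 \<xi>"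
    and c_le: "c1 \<xi> \<le> C" "c2 \<xi> \<le> C" "c3 \<xi> \<le> C"
    using g[OF \<xi>(1)] by (auto simp: c1_def c2_def c3_def C_def edge_cosh_mono)
  have "edge_cosh \<delta> > 1"
    using \<open>\<delta> > 0\<close> by (rule edge_cosh_gt_1)
  then have c_gt: "c1 \<xi> > 1" "c2 \<xi> > 1" "c3 \<xi> > 1"
    using c_ge by auto
  have D_pos: "D \<xi> > 0"
    unfolding D_def using hexagon_disc_ge_4[of "c1 \<xi>" "c2 \<xi>" "c3 \<xi>"] c_gt by simp
  have D_le: "D \<xi> \<le> sqrt (hexagon_disc C C C)"
    unfolding D_def using c_gt c_le by (intro real_sqrt_le_mono hexagon_disc_mono) auto
  define S where "S = d1\<^sup>2 + d2\<^sup>2 + d3\<^sup>2"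
  have "Q \<xi> \<le> - 2 * ((c1 \<xi> - 1) * d1\<^sup>2 + (c2 \<xi> - 1) * d2\<^sup>2 + (c3 \<xi> - 1) * d3\<^sup>2)"
    unfolding Q_def using c_gt by (intro hexagon_slope_quadratic_form) auto
  also have "\<dots> \<le> - 2 * ((edge_cosh \<delta> - 1) * S)"
  proof -
    have "(edge_cosh \<delta> - 1) * d1\<^sup>2 \<le> (c1 \<xi> - 1) * d1\<^sup>2" "(edge_cosh \<delta> - 1) * d2\<^sup>2 \<le> (c2 \<xi> - 1) * d2\<^sup>2"
      "(edge_cosh \<delta> - 1) * d3\<^sup>2 \<le> (c3 \<xi> - 1) * d3\<^sup>2"
      using c_ge by (auto intro!: mult_right_mono)
    then show ?thesis
      by (simp add: S_def distrib_left)
  qed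
  finally have "2 / D \<xi> * Q \<xi> \<le> 2 / D \<xi> * (- 2 * ((edge_cosh \<delta> - 1) * S))"
    using D_pos by (intro mult_left_mono) auto
  also have "\<dots> = - (8 * (exp (2 * \<delta>) - 1) * S / D \<xi>)"
    by (simp add: edge_cosh_def divide_simps)
  also have "\<dots> \<le> - (8 * (exp (2 * \<delta>) - 1) * S / sqrt (hexagon_disc C C C))"
    using D_pos D_le \<open>\<delta> > 0\<close> less_le_trans[OF D_pos D_le]
    by (intro le_imp_neg_le divide_left_mono mult_pos_pos) (auto simp: S_def)
  also have "\<dots> = - monotonicity_const \<delta> R * S"
    by (simp add: monotonicity_const_def C_def)
  finally have "\<phi> 1 - \<phi> 0 \<le> - monotonicity_const \<delta> R * S"
    by (simp only: \<xi>)
  then show ?thesis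
    by (simp add: \<phi>_def c1_def c2_def c3_def g1_def g2_def g3_def S_def d1_def d2_def d3_def
        algebra_simps)
qed

lemma monotonicity_const_pos:
  assumes "\<delta> > 0" "R \<ge> 0"
  shows "monotonicity_const \<delta> R > 0"
proof -
  have "edge_cosh R \<ge> 1"
    using assms by (simp add: edge_cosh_def)
  then have "hexagon_disc (edge_cosh R) (edge_cosh R) (edge_cosh R) > 0"
    using hexagon_disc_ge_4[of "edge_cosh R" "edge_cosh R" "edge_cosh R"] by simp
  then show ?thesis
    using assms by (simp add: monotonicity_const_def)
qed

text \<open>The discriminant is at least 4, so the factor \<open>2 / sqrt (hexagon_disc ...)\<close>
  is at most 1 and only the coefficients of the slope matter. The opposite edge contributes
  \<open>edge_cosh R + 1\<close>, the adjacent edges the fraction, which blows up as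
  \<open>\<delta>\<close> tends to 0.\<close>

lemma hexagon_side_lipschitz:
  assumes "\<delta> > 0"
    and s: "s1 \<in> {\<delta>..R}" "s2 \<in> {\<delta>..R}" "s3 \<in> {\<delta>..R}"
    and r: "r1 \<in> {\<delta>..R}" "r2 \<in> {\<delta>..R}" "r3 \<in> {\<delta>..R}"
  shows "\<bar>hexagon_side (edge_cosh s1) (edge_cosh s2) (edge_cosh s3)
      - hexagon_side (edge_cosh r1) (edge_cosh r2) (edge_cosh r3)\<bar>
    \<le> (edge_cosh R + 1 + (edge_cosh R + edge_cosh R * edge_cosh R) / (edge_cosh \<delta> - 1))
      * (\<bar>s1 - r1\<bar> + \<bar>s2 - r2\<bar> + \<bar>s3 - r3\<bar>)"
proof -
  define g1 g2 g3 where "g1 t = r1 + t * (s1 - r1)" and "g2 t = r2 + t * (s2 - r2)"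
    and "g3 t = r3 + t * (s3 - r3)" for t
  define c1 c2 c3 where "c1 t = edge_cosh (g1 t)" and "c2 t = edge_cosh (g2 t)"
    and "c3 t = edge_cosh (g3 t)" for t
  have g: "g1 t \<in> {\<delta>..R}" "g2 t \<in> {\<delta>..R}" "g3 t \<in> {\<delta>..R}" if "t \<in> {0..1}" for t
    using that s r segment_bounds[OF s(1) r(1), of t] segment_bounds[OF s(2) r(2), of t]
      segment_bounds[OF s(3) r(3), of t]
    unfolding g1_def g2_def g3_def by (cases "t = 0 \<or> t = 1"; force)+
  have g': "(g1 has_real_derivative s1 - r1) (at t)" "(g2 has_real_derivative s2 - r2) (at t)"
    "(g3 has_real_derivative s3 - r3) (at t)" for t
    unfolding g1_def g2_def g3_def by (auto intro!: derivative_eq_intros)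
  define \<phi> where "\<phi> t = hexagon_side (c1 t) (c2 t) (c3 t)" for t
  define D where "D t = sqrt (hexagon_disc (c1 t) (c2 t) (c3 t))" for t
  define Q where "Q t = hexagon_slope (c1 t) (c2 t) (c3 t) (s1 - r1) (s2 - r2) (s3 - r3)" for t
  have deriv: "(\<phi> has_real_derivative 2 / D t * Q t) (at t)" if t: "t \<in> {0..1}" for t
    unfolding \<phi>_def D_def Q_def c1_def c2_def c3_def
    using g[OF t] \<open>\<delta> > 0\<close> by (intro hexagon_side_edge_deriv g') auto
  have "\<exists>\<xi>::real. 0 < \<xi> \<and> \<xi> < 1 \<and> \<phi> 1 - \<phi> 0 = (1 - 0) * (2 / D \<xi> * Q \<xi>)"
    using deriv by (intro MVT2) auto
  then obtain \<xi> where \<xi>: "\<xi> \<in> {0..1}" "\<phi> 1 - \<phi> 0 = 2 / D \<xi> * Q \<xi>"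
    by (metis atLeastAtMost_iff less_imp_le diff_zero mult_1)
  define C X where "C = edge_cosh R" and "X = edge_cosh \<delta> - 1"
  have c_ge: "X \<le> c1 \<xi> - 1" "X \<le> c2 \<xi> - 1" "X \<le> c3 \<xi> - 1"
    and c_le: "c1 \<xi> \<le> C" "c2 \<xi> \<le> C" "c3 \<xi> \<le> C"
    using g[OF \<xi>(1)] by (auto simp: c1_def c2_def c3_def C_def X_def edge_cosh_mono)
  have X: "X > 0"
    using edge_cosh_gt_1[OF \<open>\<delta> > 0\<close>] by (simp add: X_def)
  then have c_gt: "c1 \<xi> > 1" "c2 \<xi> > 1" "c3 \<xi> > 1"
    using c_ge by auto
  have "sqrt 4 \<le> D \<xi>"
    unfolding D_def using c_gt by (intro real_sqrt_le_mono hexagon_disc_ge_4) auto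
  then have D: "D \<xi> \<ge> 2"
    by simp
  define M where "M = (C + C * C) / X"
  have "C \<ge> 1"
    using c_gt c_le by linarith
  then have "M \<ge> 0"
    using X by (simp add: M_def)
  have frac: "\<bar>(z + u * v) / (w - 1)\<bar> \<le> M" if "1 < z" "z \<le> C" "1 < u" "u \<le> C" "1 < v" "v \<le> C" "X \<le> w - 1"
    for u v w z
  proof -
    have "u * v \<le> C * C"
      using that by (intro mult_mono) auto
    then have "(z + u * v) / (w - 1) \<le> M"
      unfolding M_def using that X \<open>C \<ge> 1\<close> by (intro frac_le) auto
    moreover have "(z + u * v) / (w - 1) \<ge> 0"
      using that X by (intro divide_nonneg_pos add_nonneg_nonneg mult_nonneg_nonneg) auto
    ultimately show ?thesis
      by (simp only: abs_of_nonneg)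
  qed
  have "\<bar>Q \<xi>\<bar> \<le> \<bar>(c1 \<xi> + 1) * (s1 - r1)\<bar> + \<bar>(c3 \<xi> + c1 \<xi> * c2 \<xi>) / (c2 \<xi> - 1) * (s2 - r2)\<bar>
      + \<bar>(c2 \<xi> + c1 \<xi> * c3 \<xi>) / (c3 \<xi> - 1) * (s3 - r3)\<bar>"
    unfolding Q_def hexagon_slope_def by (intro order_trans[OF abs_triangle_ineq4] add_mono order_refl)
  also have "\<dots> \<le> (C + 1 + M) * \<bar>s1 - r1\<bar> + (C + 1 + M) * \<bar>s2 - r2\<bar> + (C + 1 + M) * \<bar>s3 - r3\<bar>"
  proof (intro add_mono)
    show "\<bar>(c1 \<xi> + 1) * (s1 - r1)\<bar> \<le> (C + 1 + M) * \<bar>s1 - r1\<bar>"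
      unfolding abs_mult using c_gt c_le \<open>M \<ge> 0\<close> by (intro mult_right_mono) auto
    show "\<bar>(c3 \<xi> + c1 \<xi> * c2 \<xi>) / (c2 \<xi> - 1) * (s2 - r2)\<bar> \<le> (C + 1 + M) * \<bar>s2 - r2\<bar>"
      unfolding abs_mult using frac[of "c3 \<xi>" "c1 \<xi>" "c2 \<xi>" "c2 \<xi>"] c_gt c_le c_ge \<open>C \<ge> 1\<close>
      by (intro mult_right_mono) auto
    show "\<bar>(c2 \<xi> + c1 \<xi> * c3 \<xi>) / (c3 \<xi> - 1) * (s3 - r3)\<bar> \<le> (C + 1 + M) * \<bar>s3 - r3\<bar>"
      unfolding abs_mult using frac[of "c2 \<xi>" "c1 \<xi>" "c3 \<xi>" "c3 \<xi>"] c_gt c_le c_ge \<open>C \<ge> 1\<close>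
      by (intro mult_right_mono) auto
  qed
  also have "\<dots> = (C + 1 + M) * (\<bar>s1 - r1\<bar> + \<bar>s2 - r2\<bar> + \<bar>s3 - r3\<bar>)"
    by (simp add: distrib_left)
  finally have Q_le: "\<bar>Q \<xi>\<bar> \<le> (C + 1 + M) * (\<bar>s1 - r1\<bar> + \<bar>s2 - r2\<bar> + \<bar>s3 - r3\<bar>)" .
  have "\<bar>\<phi> 1 - \<phi> 0\<bar> = 2 / D \<xi> * \<bar>Q \<xi>\<bar>"
    unfolding \<xi> abs_mult using D by simp
  also have "\<dots> \<le> 1 * \<bar>Q \<xi>\<bar>"
    using D by (intro mult_right_mono) auto
  finally have "\<bar>\<phi> 1 - \<phi> 0\<bar> \<le> (C + 1 + M) * (\<bar>s1 - r1\<bar> + \<bar>s2 - r2\<bar> + \<bar>s3 - r3\<bar>)"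
    using Q_le by simp
  then show ?thesis
    by (simp add: \<phi>_def c1_def c2_def c3_def g1_def g2_def g3_def C_def M_def X_def)
qed

section \<open>Long and short sides of degenerating hexagons\<close>

lemma hexagon_side_nonneg:
  assumes "a > 1" "b > 1" "d > 1"
  shows "hexagon_side a b d \<ge> 0"
  unfolding hexagon_side_def using hexagon_side_arg(1)[OF assms] by simp

lemma arcosh_ge:
  fixes u :: real
  assumes "\<beta> \<ge> 0" "cosh \<beta> \<le> u"
  shows "\<beta> \<le> arcosh u"
proof -
  have "1 \<le> cosh \<beta>"
    by (rule cosh_real_ge_1)
  then have "cosh \<beta> \<le> cosh (arcosh u)"
    using assms by (subst cosh_arcosh_real) auto
  then show ?thesis
    using assms cosh_real_nonneg_le_iff[of \<beta> "arcosh u"] \<open>1 \<le> cosh \<beta>\<close> by simp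
qed

lemma arcosh_le:
  fixes u :: real
  assumes "\<beta> \<ge> 0" "1 \<le> u" "u \<le> cosh \<beta>"
  shows "arcosh u \<le> \<beta>"
proof -
  have "cosh (arcosh u) \<le> cosh \<beta>"
    using assms by (subst cosh_arcosh_real) auto
  then show ?thesis
    using assms cosh_real_nonneg_le_iff[of "arcosh u" \<beta>] by simp
qed

lemma sqrt_square_minus_1_bounds:
  fixes b :: real
  assumes "b > 1"
  shows "sqrt (b\<^sup>2 - 1) > 0" "sqrt (b\<^sup>2 - 1) \<le> b" "b - 1 \<le> sqrt (b\<^sup>2 - 1)"
    "b \<le> 1 + sqrt (b\<^sup>2 - 1)"
proof -
  show "sqrt (b\<^sup>2 - 1) > 0"
    using assms by (simp add: one_less_power)
  have "sqrt (b\<^sup>2 - 1) \<le> sqrt (b\<^sup>2)"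
    by (intro real_sqrt_le_mono) simp
  then show "sqrt (b\<^sup>2 - 1) \<le> b"
    using assms by simp
  have "(b - 1)\<^sup>2 \<le> b\<^sup>2 - 1"
    using assms by (simp add: power2_eq_square algebra_simps)
  then show "b - 1 \<le> sqrt (b\<^sup>2 - 1)"
    by (rule real_le_rsqrt)
  then show "b \<le> 1 + sqrt (b\<^sup>2 - 1)"
    by simp
qed

text \<open>From \<open>b \<ge> 1\<close> and \<open>d \<ge> sqrt (d\<^sup>2 - 1)\<close> the
  hyperbolic cosine of the side is at least \<open>1 / sqrt (b\<^sup>2 - 1)\<close>, however long
  the other two edges are. Hence a short edge forces a long neighbouring side.\<close>

lemma hexagon_side_ge_adjacent:
  assumes "a > 1" "b > 1" "d > 1" "\<beta> \<ge> 0" "cosh \<beta> * sqrt (b\<^sup>2 - 1) \<le> 1"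
  shows "\<beta> \<le> hexagon_side a b d"
proof -
  note sb = sqrt_square_minus_1_bounds[OF \<open>b > 1\<close>] and sd = sqrt_square_minus_1_bounds[OF \<open>d > 1\<close>]
  have "cosh \<beta> * (sqrt (b\<^sup>2 - 1) * sqrt (d\<^sup>2 - 1)) \<le> 1 * sqrt (d\<^sup>2 - 1)"
    unfolding mult.assoc[symmetric] using assms sd by (intro mult_right_mono) auto
  also have "\<dots> \<le> b * d"
    using sd assms by (intro mult_mono) auto
  also have "\<dots> \<le> a + b * d"
    using assms by simp
  finally have "cosh \<beta> \<le> (a + b * d) / (sqrt (b\<^sup>2 - 1) * sqrt (d\<^sup>2 - 1))"
    using sb sd by (subst pos_le_divide_eq) auto
  then show ?thesis
    unfolding hexagon_side_def using \<open>\<beta> \<ge> 0\<close> by (intro arcosh_ge)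
qed

text \<open>Only the term \<open>a / (sqrt (b\<^sup>2 - 1) * sqrt (d\<^sup>2 - 1))\<close> is kept.
  The 4 pays for the bound \<open>edge_cosh s \<le> 2 * exp (2 * s)\<close> at both adjacent
  edges.\<close>

lemma hexagon_side_ge_opposite:
  assumes "s1 > 0" "s2 > 0" "s3 > 0" "\<beta> \<ge> 0" "4 * cosh \<beta> \<le> exp (2 * (s1 - s2 - s3))"
  shows "\<beta> \<le> hexagon_side (edge_cosh s1) (edge_cosh s2) (edge_cosh s3)"
proof -
  define a b d where "a = edge_cosh s1" and "b = edge_cosh s2" and "d = edge_cosh s3"
  have gt: "a > 1" "b > 1" "d > 1"
    using assms by (auto simp: edge_cosh_gt_1 a_def b_def d_def)
  note sb = sqrt_square_minus_1_bounds[OF \<open>b > 1\<close>] and sd = sqrt_square_minus_1_bounds[OF \<open>d > 1\<close>]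
  have "sqrt (b\<^sup>2 - 1) * sqrt (d\<^sup>2 - 1) \<le> b * d"
    using sb sd gt by (intro mult_mono) auto
  also have "\<dots> \<le> (2 * exp (2 * s2)) * (2 * exp (2 * s3))"
    using gt edge_cosh_bounds[OF \<open>s2 > 0\<close>] edge_cosh_bounds[OF \<open>s3 > 0\<close>]
    by (intro mult_mono) (auto simp: b_def d_def)
  finally have "cosh \<beta> * (sqrt (b\<^sup>2 - 1) * sqrt (d\<^sup>2 - 1))
      \<le> cosh \<beta> * ((2 * exp (2 * s2)) * (2 * exp (2 * s3)))"
    by (intro mult_left_mono) auto
  also have "\<dots> = (4 * cosh \<beta>) * exp (2 * s2) * exp (2 * s3)"
    by simp
  also have "\<dots> \<le> exp (2 * (s1 - s2 - s3)) * exp (2 * s2) * exp (2 * s3)"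
    using assms by (intro mult_right_mono) auto
  also have "\<dots> = exp (2 * s1)"
    by (simp add: algebra_simps flip: exp_add)
  also have "\<dots> \<le> a + b * d"
    using edge_cosh_bounds[OF \<open>s1 > 0\<close>] gt by (simp add: a_def add_increasing2)
  finally have "cosh \<beta> \<le> (a + b * d) / (sqrt (b\<^sup>2 - 1) * sqrt (d\<^sup>2 - 1))"
    using sb sd by (subst pos_le_divide_eq) auto
  then show ?thesis
    unfolding hexagon_side_def a_def b_def d_def using \<open>\<beta> \<ge> 0\<close> by (intro arcosh_ge)
qed

text \<open>The hyperbolic cosine of the side splits into \<open>a / (p * q)\<close>, small when the
  opposite edge is short compared with the adjacent ones, and \<open>(b / p) * (d / q)\<close>,
  close to 1 when both adjacent edges are long. The condition \<open>T \<ge> 1\<close> ensures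
  \<open>exp (2 * s) \<le> edge_cosh s - 1\<close>.\<close>

lemma hexagon_side_le:
  assumes "s1 > 0" "s2 \<ge> T" "s3 \<ge> T" "T \<ge> 1" "\<beta> \<ge> 0"
    and le: "2 * exp (2 * (s1 - s2 - s3)) + (1 + exp (- (2 * T)))\<^sup>2 \<le> cosh \<beta>"
  shows "hexagon_side (edge_cosh s1) (edge_cosh s2) (edge_cosh s3) \<le> \<beta>"
proof -
  define a b d where "a = edge_cosh s1" and "b = edge_cosh s2" and "d = edge_cosh s3"
  have gt: "a > 1" "b > 1" "d > 1"
    using assms by (auto simp: edge_cosh_gt_1 a_def b_def d_def)
  define p q where "p = sqrt (b\<^sup>2 - 1)" and "q = sqrt (d\<^sup>2 - 1)"
  note sb = sqrt_square_minus_1_bounds[OF \<open>b > 1\<close>, folded p_def]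
    and sd = sqrt_square_minus_1_bounds[OF \<open>d > 1\<close>, folded q_def]
  have *: "exp (2 * s) \<le> edge_cosh s - 1" if "s \<ge> T" for s
    using exp_ge_add_one_self[of "2 * s"] that \<open>T \<ge> 1\<close> unfolding edge_cosh_def by linarith
  have p: "exp (2 * s2) \<le> p" and q: "exp (2 * s3) \<le> q"
    using *[of s2] *[of s3] sb sd assms by (auto simp: b_def d_def)
  have ratio: "c / r \<le> 1 + exp (- (2 * T))" if "exp (2 * s) \<le> r" "s \<ge> T" "c \<le> 1 + r" for c r s
  proof -
    have "r > 0"
      using that(1) exp_gt_zero less_le_trans by blast
    have "c / r \<le> (1 + r) / r"
      using that \<open>r > 0\<close> by (intro divide_right_mono) auto
    also have "\<dots> = 1 + 1 / r"
      using \<open>r > 0\<close> by (simp add: field_simps)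
    also have "1 / r \<le> 1 / exp (2 * s)"
      using that by (intro divide_left_mono) (auto simp: \<open>r > 0\<close>)
    also have "1 / exp (2 * s) = exp (- (2 * s))"
      by (simp add: exp_minus field_simps)
    also have "\<dots> \<le> exp (- (2 * T))"
      using that by simp
    finally show ?thesis
      by simp
  qed
  have "a / (p * q) \<le> 2 * exp (2 * s1) / (exp (2 * s2) * exp (2 * s3))"
    using edge_cosh_bounds[OF \<open>s1 > 0\<close>] p q gt sb(1) sd(1)
    by (intro frac_le mult_mono) (auto simp: a_def)
  also have "\<dots> = 2 * exp (2 * (s1 - s2 - s3))"
    by (simp add: exp_diff right_diff_distrib)
  finally have 1: "a / (p * q) \<le> 2 * exp (2 * (s1 - s2 - s3))" .
  have 2: "(b / p) * (d / q) \<le> (1 + exp (- (2 * T))) * (1 + exp (- (2 * T)))"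
    using ratio[OF p] ratio[OF q] assms sb sd gt by (intro mult_mono) auto
  have "(a + b * d) / (p * q) = a / (p * q) + (b / p) * (d / q)"
    by (simp add: add_divide_distrib)
  also have "\<dots> \<le> cosh \<beta>"
    using 1 2 le by (simp add: power2_eq_square)
  finally show ?thesis
    using hexagon_side_arg(1)[OF gt] \<open>\<beta> \<ge> 0\<close>
    unfolding hexagon_side_def a_def b_def d_def p_def q_def by (intro arcosh_le) auto
qed

section \<open>The vector field of the flow\<close>

locale ideal_triangulation =
  fixes F :: "'f set" and vert :: "'f \<Rightarrow> nat \<Rightarrow> 'v::finite"
    and edg :: "'f \<Rightarrow> nat \<Rightarrow> 'e" and ends :: "'e \<Rightarrow> 'v \<times> 'v"
    and l0 :: "'e \<Rightarrow> real" and b :: "'v \<Rightarrow> real"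
  assumes tri: "tri_data F vert edg ends"
    and b_pos: "b i > 0"
begin

abbreviation E :: "'e set" where
  "E \<equiv> edges_of F edg"

definition corners :: "('f \<times> nat) set" where
  "corners = F \<times> {..<3}"

definition kappa :: "'e \<Rightarrow> real" where
  "kappa e = ln (cosh (l0 e / 2))"

text \<open>For admissible \<open>x\<close>, the edge \<open>e\<close> of the metric with conformal factor \<open>x\<close> has length \<open>l\<close> with
  \<open>cosh (l / 2) = exp (edge_wt x e)\<close>.\<close>

definition edge_wt :: "real ^ 'v \<Rightarrow> 'e \<Rightarrow> real" where
  "edge_wt x e = x $ fst (ends e) + x $ snd (ends e) + kappa e"

definition W :: "(real ^ 'v) set" where
  "W = {x. \<forall>e\<in>E. edge_wt x e > 0}"

definition theta :: "real ^ 'v \<Rightarrow> 'f \<Rightarrow> nat \<Rightarrow> real" where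
  "theta x f c = hexagon_side (edge_cosh (edge_wt x (edg f c)))
     (edge_cosh (edge_wt x (edg f ((c + 1) mod 3)))) (edge_cosh (edge_wt x (edg f ((c + 2) mod 3))))"

text \<open>The right-hand side of the flow as a field on \<open>real ^ 'v\<close>, where inner
  products, projections and Brouwer's theorem are available; \<open>($) x\<close> passes back to
  functions on the boundary components.\<close>

definition V :: "real ^ 'v \<Rightarrow> real ^ 'v" where
  "V x = (\<chi> i. bdry_len F vert edg ends l0 (($) x) i - b i)"

section \<open>Faces, edges and corners, and the lengths in terms of edge weights\<close>

lemma finite_F: "finite F"
  using tri by (simp add: tri_data_def)

lemma finite_corners: "finite corners"
  by (simp add: corners_def finite_F)

lemma edge_in_E: "f \<in> F \<Longrightarrow> edg f (c mod 3) \<in> E"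
  unfolding edges_of_def by (intro CollectI exI[of _ f] exI[of _ "c mod 3"]) simp

lemma edge_in_E': "f \<in> F \<Longrightarrow> c < 3 \<Longrightarrow> edg f c \<in> E"
  using edge_in_E[of f c] by simp

lemma finite_E: "finite E"
proof -
  have "E = (\<lambda>(f, c). edg f c) ` corners"
    by (auto simp: edges_of_def corners_def)
  then show ?thesis
    by (simp add: finite_corners)
qed

lemma vertex_occurs:
  obtains f c where "f \<in> F" "c < 3" "vert f c = i"
  using tri unfolding tri_data_def by blast

lemma E_nonempty: "E \<noteq> {}"
  \<comment> \<open>Any vertex would do, since each one is a corner of some face.\<close>
  by (rule vertex_occurs[of undefined]) (use edge_in_E' in blast)

lemma ends_face:
  assumes "f \<in> F" "c < 3"
  shows "ends (edg f c) = (vert f ((c + 1) mod 3), vert f ((c + 2) mod 3)) \<or>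
    ends (edg f c) = (vert f ((c + 2) mod 3), vert f ((c + 1) mod 3))"
  using tri assms unfolding tri_data_def by blast

lemma edge_wt_face:
  assumes "f \<in> F" "c < 3"
  shows "edge_wt x (edg f c) = x $ vert f ((c + 1) mod 3) + x $ vert f ((c + 2) mod 3) + kappa (edg f c)"
  using ends_face[OF assms] by (auto simp: edge_wt_def)

lemma kappa_nonneg: "kappa e \<ge> 0"
  by (simp add: kappa_def cosh_real_ge_1)

lemma kappa_bounded: "\<exists>k\<ge>0. \<forall>e\<in>E. kappa e \<le> k"
  using finite_E kappa_nonneg
  by (intro exI[of _ "\<Sum>e\<in>E. kappa e"]) (auto intro!: sum_nonneg member_le_sum)

lemma admissible_iff: "($) x \<in> admissible F edg ends l0 \<longleftrightarrow> x \<in> W"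
  by (auto simp: admissible_def W_def edge_wt_def kappa_def)

text \<open>The double-angle formula turns \<open>cosh (l / 2) = exp s\<close> into
  \<open>cosh l = 2 * exp (2 * s) - 1\<close>; nonnegativity of \<open>l\<close> selects the
  positive root for \<open>sinh l\<close>.\<close>

lemma conf_len_cosh_sinh:
  assumes "edge_wt x e > 0"
  shows "cosh (conf_len ends l0 (($) x) e) = edge_cosh (edge_wt x e)"
    and "sinh (conf_len ends l0 (($) x) e) = sqrt ((edge_cosh (edge_wt x e))\<^sup>2 - 1)"
proof -
  have "exp (edge_wt x e) = exp (x $ fst (ends e) + x $ snd (ends e)) * cosh (l0 e / 2)"
    by (simp add: edge_wt_def kappa_def exp_add cosh_real_pos)
  then have l: "conf_len ends l0 (($) x) e = 2 * arcosh (exp (edge_wt x e))"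
    by (simp add: conf_len_def)
  have ge: "exp (edge_wt x e) \<ge> 1"
    using assms by simp
  have "cosh (2 * arcosh (exp (edge_wt x e))) = 2 * (exp (edge_wt x e))\<^sup>2 - 1"
    using ge by (simp add: cosh_double_cosh cosh_arcosh_real)
  then show c: "cosh (conf_len ends l0 (($) x) e) = edge_cosh (edge_wt x e)"
    by (simp add: l edge_cosh_def exp_double)
  have "sinh (conf_len ends l0 (($) x) e) \<ge> 0"
    using ge by (simp add: l)
  then show "sinh (conf_len ends l0 (($) x) e) = sqrt ((edge_cosh (edge_wt x e))\<^sup>2 - 1)"
    unfolding c[symmetric] by (simp add: cosh_square_eq)
qed

lemma hex_theta_eq:
  assumes "x \<in> W" "f \<in> F" "c < 3"
  shows "hex_theta edg (conf_len ends l0 (($) x)) f c = theta x f c"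
proof -
  have "edge_wt x (edg f c) > 0" "edge_wt x (edg f ((c + 1) mod 3)) > 0" "edge_wt x (edg f ((c + 2) mod 3)) > 0"
    using assms edge_in_E edge_in_E' by (auto simp: W_def)
  then show ?thesis
    by (simp add: hex_theta_def theta_def hexagon_side_def conf_len_cosh_sinh)
qed

lemma bdry_len_eq:
  assumes "x \<in> W"
  shows "bdry_len F vert edg ends l0 (($) x) i =
    (\<Sum>p\<in>{p\<in>corners. vert (fst p) (snd p) = i}. theta x (fst p) (snd p))"
  unfolding bdry_len_def
  by (rule sum.cong) (auto simp: corners_def hex_theta_eq[OF assms])

section \<open>Monotonicity and Lipschitz continuity of the field, face by face\<close>

lemma sum_corners_by_vertex:
  "(\<Sum>i\<in>UNIV. \<Sum>p\<in>{p\<in>corners. vert (fst p) (snd p) = i}. h p) = (\<Sum>p\<in>corners. h p)"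
  for h :: "'f \<times> nat \<Rightarrow> real"
  using sum.group[OF finite_corners finite_class.finite_UNIV, of "\<lambda>p. vert (fst p) (snd p)" h] by auto

lemma sum_corners_by_face: "(\<Sum>p\<in>corners. h p) = (\<Sum>f\<in>F. h (f, 0) + h (f, 1) + h (f, 2))"
  for h :: "'f \<times> nat \<Rightarrow> real"
proof -
  have "{..<3} = {0, 1, 2::nat}"
    by auto
  then show ?thesis
    unfolding corners_def using sum.cartesian_product[of "\<lambda>f c. h (f, c)" "{..<3}" F]
    by (simp add: add_ac)
qed

text \<open>Every vertex is a corner of at least one face, so no coordinate is lost. This turns the
  sum of the face estimates into an estimate by the Euclidean norm.\<close>

lemma sum_squares_le_corners: "(\<Sum>i\<in>UNIV. (d $ i)\<^sup>2) \<le> (\<Sum>p\<in>corners. (d $ vert (fst p) (snd p))\<^sup>2)"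
  for d :: "real ^ 'v"
  unfolding sum_corners_by_vertex[symmetric]
proof (rule sum_mono)
  fix i
  obtain f c where fc: "f \<in> F" "c < 3" "vert f c = i"
    by (rule vertex_occurs)
  have "(d $ vert (fst (f, c)) (snd (f, c)))\<^sup>2
      \<le> (\<Sum>p\<in>{p\<in>corners. vert (fst p) (snd p) = i}. (d $ vert (fst p) (snd p))\<^sup>2)"
    by (rule member_le_sum) (use fc finite_corners in \<open>auto simp: corners_def\<close>)
  then show "(d $ i)\<^sup>2 \<le> (\<Sum>p\<in>{p\<in>corners. vert (fst p) (snd p) = i}. (d $ vert (fst p) (snd p))\<^sup>2)"
    using fc by simp
qed

text \<open>The inner product is a sum over vertices of sums over their corners; regrouped by faces
  it consists of exactly the expressions bounded for a single hexagon. The targets \<open>b\<close>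
  cancel in the difference of the fields.\<close>

lemma V_strongly_monotone:
  assumes "\<delta> > 0" and x: "\<And>e. e \<in> E \<Longrightarrow> edge_wt x e \<in> {\<delta>..R}" and y: "\<And>e. e \<in> E \<Longrightarrow> edge_wt y e \<in> {\<delta>..R}"
  shows "(x - y) \<bullet> (V x - V y) \<le> - monotonicity_const \<delta> R * ((x - y) \<bullet> (x - y))"
proof -
  have W: "x \<in> W" "y \<in> W"
    using x y \<open>\<delta> > 0\<close> by (force simp: W_def)+
  obtain e where "e \<in> E"
    using E_nonempty by blast
  then have "R \<ge> 0"
    using x[of e] \<open>\<delta> > 0\<close> by auto
  define d where "d = x - y"
  define h where "h p = d $ vert (fst p) (snd p) * (theta x (fst p) (snd p) - theta y (fst p) (snd p))" for p
  have "(x - y) \<bullet> (V x - V y)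
      = (\<Sum>i\<in>UNIV. \<Sum>p\<in>{p\<in>corners. vert (fst p) (snd p) = i}. h p)"
    unfolding inner_vec_def
  proof (rule sum.cong)
    fix i
    have "(x - y) $ i \<bullet> (V x - V y) $ i = d $ i *
        (\<Sum>p\<in>{p\<in>corners. vert (fst p) (snd p) = i}. theta x (fst p) (snd p) - theta y (fst p) (snd p))"
      by (simp add: V_def bdry_len_eq W sum_subtractf d_def)
    also have "\<dots> = (\<Sum>p\<in>{p\<in>corners. vert (fst p) (snd p) = i}. h p)"
      unfolding sum_distrib_left by (rule sum.cong) (auto simp: h_def)
    finally show "(x - y) $ i \<bullet> (V x - V y) $ i
        = (\<Sum>p\<in>{p\<in>corners. vert (fst p) (snd p) = i}. h p)" .
  qed simp
  also have "\<dots> = (\<Sum>f\<in>F. h (f, 0) + h (f, 1) + h (f, 2))"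
    by (simp only: sum_corners_by_vertex sum_corners_by_face)
  also have "\<dots> \<le> (\<Sum>f\<in>F. - monotonicity_const \<delta> R *
      ((d $ vert f 0)\<^sup>2 + (d $ vert f 1)\<^sup>2 + (d $ vert f 2)\<^sup>2))"
  proof (rule sum_mono)
    fix f assume f: "f \<in> F"
    have mod: "(2 + 2) mod 3 = (1::nat)" "(1 + 2) mod 3 = (0::nat)" "(2 + 1) mod 3 = (0::nat)"
      "(0 + 2) mod 3 = (2::nat)" "(0 + 1) mod 3 = (1::nat)" "(1 + 1) mod 3 = (2::nat)"
      by simp_all
    have s: "edge_wt z (edg f 0) = z $ vert f 1 + z $ vert f 2 + kappa (edg f 0)"
      "edge_wt z (edg f 1) = z $ vert f 2 + z $ vert f 0 + kappa (edg f 1)"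
      "edge_wt z (edg f 2) = z $ vert f 0 + z $ vert f 1 + kappa (edg f 2)" for z
      using edge_wt_face[OF f, of 0 z] edge_wt_face[OF f, of 1 z] edge_wt_face[OF f, of 2 z]
      unfolding mod by simp_all
    have e: "edg f 0 \<in> E" "edg f 1 \<in> E" "edg f 2 \<in> E"
      using f by (auto intro: edge_in_E')
    have t: "theta z f 0 = hexagon_side (edge_cosh (edge_wt z (edg f 0))) (edge_cosh (edge_wt z (edg f 1))) (edge_cosh (edge_wt z (edg f 2)))"
      "theta z f 1 = hexagon_side (edge_cosh (edge_wt z (edg f 1))) (edge_cosh (edge_wt z (edg f 2))) (edge_cosh (edge_wt z (edg f 0)))"
      "theta z f 2 = hexagon_side (edge_cosh (edge_wt z (edg f 2))) (edge_cosh (edge_wt z (edg f 0))) (edge_cosh (edge_wt z (edg f 1)))" for z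
      unfolding theta_def mod by simp_all
    show "h (f, 0) + h (f, 1) + h (f, 2)
        \<le> - monotonicity_const \<delta> R * ((d $ vert f 0)\<^sup>2 + (d $ vert f 1)\<^sup>2 + (d $ vert f 2)\<^sup>2)"
      using hexagon_strongly_monotone[of \<delta> "x $ vert f 1" "x $ vert f 2" "kappa (edg f 0)" R
          "x $ vert f 0" "kappa (edg f 1)" "kappa (edg f 2)" "y $ vert f 1" "y $ vert f 2" "y $ vert f 0",
          OF \<open>\<delta> > 0\<close>, folded s, OF x[OF e(1)] x[OF e(2)] x[OF e(3)]
          y[OF e(1)] y[OF e(2)] y[OF e(3)]]
      unfolding h_def fst_conv snd_conv t d_def vector_minus_component .
  qed
  also have "\<dots> = - monotonicity_const \<delta> R * (\<Sum>p\<in>corners. (d $ vert (fst p) (snd p))\<^sup>2)"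
    unfolding sum_corners_by_face sum_distrib_left by simp
  also have "\<dots> \<le> - monotonicity_const \<delta> R * (\<Sum>i\<in>UNIV. (d $ i)\<^sup>2)"
    using sum_squares_le_corners[of d] monotonicity_const_pos[OF \<open>\<delta> > 0\<close> \<open>R \<ge> 0\<close>]
    by (intro mult_left_mono_neg) auto
  also have "(\<Sum>i\<in>UNIV. (d $ i)\<^sup>2) = (x - y) \<bullet> (x - y)"
    by (simp add: inner_vec_def d_def power2_eq_square)
  finally show ?thesis .
qed

text \<open>With finitely many edges, any two admissible points have all their edge weights in a
  common interval with positive left end, so strong monotonicity applies with a constant depending
  on the two points.\<close>

lemma V_monotone:
  assumes "x \<in> W" "y \<in> W"
  shows "(x - y) \<bullet> (V x - V y) \<le> 0"
proof -
  define S where "S = edge_wt x ` E \<union> edge_wt y ` E"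
  have S: "finite S" "S \<noteq> {}"
    using finite_E E_nonempty by (auto simp: S_def)
  have "Min S > 0"
    using S assms by (subst Min_gr_iff) (auto simp: S_def W_def)
  moreover have "edge_wt x e \<in> {Min S..Max S}" "edge_wt y e \<in> {Min S..Max S}" if "e \<in> E" for e
    using S that by (auto simp: S_def)
  ultimately have "(x - y) \<bullet> (V x - V y) \<le> - monotonicity_const (Min S) (Max S) * ((x - y) \<bullet> (x - y))"
    by (intro V_strongly_monotone)
  also have "\<dots> \<le> 0"
    using monotonicity_const_pos[OF \<open>Min S > 0\<close>, of "Max S"] \<open>Min S > 0\<close> Min_in[OF S] Max_ge[OF S(1)]
    by (simp add: order_trans[of 0 "Min S"])
  finally show ?thesis .
qed

lemma V_lipschitz:
  assumes "\<delta> > 0"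
  shows "\<exists>L. L-lipschitz_on {x. \<forall>e\<in>E. edge_wt x e \<in> {\<delta>..R}} V"
proof -
  define A where "A = edge_cosh R + 1 + (edge_cosh R + edge_cosh R * edge_cosh R) / (edge_cosh \<delta> - 1)"
  \<comment> \<open>Each of the three edge weights at a corner is the sum of two coordinates and a
    constant, hence changes by at most \<open>2 * norm (x - y)\<close>: together 6.\<close>
  define L where "L = real (card corners) * (\<bar>A\<bar> * 6)"
  have "L-lipschitz_on {x. \<forall>e\<in>E. edge_wt x e \<in> {\<delta>..R}} V"
  proof (rule lipschitz_onI)
    fix x y assume "x \<in> {x. \<forall>e\<in>E. edge_wt x e \<in> {\<delta>..R}}" "y \<in> {x. \<forall>e\<in>E. edge_wt x e \<in> {\<delta>..R}}"
    then have x: "\<And>e. e \<in> E \<Longrightarrow> edge_wt x e \<in> {\<delta>..R}" and y: "\<And>e. e \<in> E \<Longrightarrow> edge_wt y e \<in> {\<delta>..R}"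
      by auto
    have W: "x \<in> W" "y \<in> W"
      using x y \<open>\<delta> > 0\<close> by (force simp: W_def)+
    have edge_wt: "\<bar>edge_wt x e - edge_wt y e\<bar> \<le> 2 * norm (x - y)" for e
      using component_le_norm_cart[of "x - y" "fst (ends e)"] component_le_norm_cart[of "x - y" "snd (ends e)"]
      by (simp add: edge_wt_def)
    have theta: "\<bar>theta x f c - theta y f c\<bar> \<le> \<bar>A\<bar> * 6 * norm (x - y)" if "f \<in> F" "c < 3" for f c
    proof -
      note e = edge_in_E'[OF that] edge_in_E[OF that(1), of "c + 1"] edge_in_E[OF that(1), of "c + 2"]
      have "\<bar>theta x f c - theta y f c\<bar> \<le> A * (\<bar>edge_wt x (edg f c) - edge_wt y (edg f c)\<bar>
          + \<bar>edge_wt x (edg f ((c + 1) mod 3)) - edge_wt y (edg f ((c + 1) mod 3))\<bar>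
          + \<bar>edge_wt x (edg f ((c + 2) mod 3)) - edge_wt y (edg f ((c + 2) mod 3))\<bar>)"
        unfolding theta_def A_def
        by (rule hexagon_side_lipschitz[OF \<open>\<delta> > 0\<close> x[OF e(1)] x[OF e(2)] x[OF e(3)]
              y[OF e(1)] y[OF e(2)] y[OF e(3)]])
      also have "\<dots> \<le> \<bar>A\<bar> * (2 * norm (x - y) + 2 * norm (x - y) + 2 * norm (x - y))"
        by (intro mult_mono add_mono edge_wt) auto
      finally show ?thesis
        by simp
    qed
    have "dist (V x) (V y) \<le> (\<Sum>i\<in>UNIV. \<bar>(V x - V y) $ i\<bar>)"
      unfolding dist_norm by (rule norm_le_l1_cart)
    also have "\<dots> \<le> (\<Sum>i\<in>UNIV. \<Sum>p\<in>{p\<in>corners. vert (fst p) (snd p) = i}.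
        \<bar>theta x (fst p) (snd p) - theta y (fst p) (snd p)\<bar>)"
      by (intro sum_mono) (simp add: V_def bdry_len_eq W sum_abs flip: sum_subtractf)
    also have "\<dots> \<le> (\<Sum>p\<in>corners. \<bar>A\<bar> * 6 * norm (x - y))"
      unfolding sum_corners_by_vertex by (intro sum_mono theta) (auto simp: corners_def)
    also have "\<dots> = L * dist x y"
      by (simp add: L_def dist_norm)
    finally show "dist (V x) (V y) \<le> L * dist x y" .
  qed (simp add: L_def)
  then show ?thesis ..
qed

section \<open>Direction of the field at short edges and at extreme conformal factors\<close>

lemma theta_nonneg:
  assumes "x \<in> W" "f \<in> F" "c < 3"
  shows "theta x f c \<ge> 0"
  unfolding theta_def
  using assms edge_in_E edge_in_E'
  by (intro hexagon_side_nonneg edge_cosh_gt_1) (auto simp: W_def)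

lemma theta_le_bdry_len:
  assumes "x \<in> W" "f \<in> F" "c < 3"
  shows "theta x f c \<le> bdry_len F vert edg ends l0 (($) x) (vert f c)"
proof -
  have "theta x (fst (f, c)) (snd (f, c)) \<le> bdry_len F vert edg ends l0 (($) x) (vert f c)"
    unfolding bdry_len_eq[OF assms(1)]
    by (rule member_le_sum) (use assms finite_corners theta_nonneg in \<open>auto simp: corners_def\<close>)
  then show ?thesis
    by simp
qed

lemma bdry_len_nonneg:
  assumes "x \<in> W"
  shows "bdry_len F vert edg ends l0 (($) x) i \<ge> 0"
  unfolding bdry_len_eq[OF assms] using assms theta_nonneg
  by (intro sum_nonneg) (auto simp: corners_def)

text \<open>The weight of an edge changes along the flow at the rate
  \<open>V x $ i + V x $ j\<close> for its endpoints, so it suffices that one side next to the short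
  edge exceeds the sum of both targets.\<close>

lemma V_inward_edge:
  "\<exists>\<delta>>0. \<forall>x\<in>W. \<forall>e\<in>E. edge_wt x e \<le> \<delta> \<longrightarrow> 0 \<le> V x $ fst (ends e) + V x $ snd (ends e)"
proof -
  \<comment> \<open>Each of the two targets is bounded by the total of all targets, which also
    covers edges whose endpoints coincide.\<close>
  define \<beta> where "\<beta> = 2 * (\<Sum>i\<in>UNIV. b i)"
  have b_le: "b i \<le> (\<Sum>i\<in>UNIV. b i)" for i
    using b_pos less_imp_le by (intro member_le_sum) auto
  have "\<beta> \<ge> 0"
    unfolding \<beta>_def using b_pos less_imp_le by (intro mult_nonneg_nonneg sum_nonneg) auto
  have "isCont (\<lambda>s. cosh \<beta> * sqrt ((edge_cosh s)\<^sup>2 - 1)) 0"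
    unfolding edge_cosh_def by (intro continuous_intros)
  then have "((\<lambda>s. cosh \<beta> * sqrt ((edge_cosh s)\<^sup>2 - 1)) \<longlongrightarrow> 0) (at 0)"
    by (simp add: isCont_def edge_cosh_def)
  then have "\<forall>\<^sub>F s in at 0. cosh \<beta> * sqrt ((edge_cosh s)\<^sup>2 - 1) < 1"
    by (rule order_tendstoD) simp
  then obtain \<delta> where \<delta>: "\<delta> > 0"
    "\<And>s. s \<noteq> 0 \<Longrightarrow> dist s 0 < \<delta> \<Longrightarrow> cosh \<beta> * sqrt ((edge_cosh s)\<^sup>2 - 1) < 1"
    unfolding eventually_at by blast
  have "0 \<le> V x $ fst (ends e) + V x $ snd (ends e)"
    if x: "x \<in> W" and "e \<in> E" and le: "edge_wt x e \<le> \<delta> / 2" for x e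
  proof -
    obtain f c where fc: "f \<in> F" "c < 3" "e = edg f c"
      using \<open>e \<in> E\<close> by (auto simp: edges_of_def)
    \<comment> \<open>The side at the next corner \<open>c'\<close> has \<open>e\<close> as an
      adjacent edge, in the last argument of \<open>hexagon_side\<close>, and
      \<open>vert f c'\<close> is an endpoint of \<open>e\<close>.\<close>
    define c' where "c' = (c + 1) mod 3"
    have c': "c' < 3" "(c' + 2) mod 3 = c"
      using fc(2) by (auto simp: c'_def mod_simps)
    have pos: "edge_wt x (edg f c') > 0" "edge_wt x (edg f ((c' + 1) mod 3)) > 0" "edge_wt x e > 0"
      using x fc \<open>e \<in> E\<close> c' edge_in_E edge_in_E' by (auto simp: W_def)
    have "cosh \<beta> * sqrt ((edge_cosh (edge_wt x e))\<^sup>2 - 1) < 1"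
      using \<delta>(1) le pos by (intro \<delta>(2)) (auto simp: dist_real_def)
    then have "\<beta> \<le> hexagon_side (edge_cosh (edge_wt x (edg f c'))) (edge_cosh (edge_wt x e))
        (edge_cosh (edge_wt x (edg f ((c' + 1) mod 3))))"
      using pos \<open>\<beta> \<ge> 0\<close> by (intro hexagon_side_ge_adjacent edge_cosh_gt_1) auto
    then have "\<beta> \<le> theta x f c'"
      unfolding theta_def c'(2) fc(3) by (subst hexagon_side_commute)
    also have "\<dots> \<le> bdry_len F vert edg ends l0 (($) x) (vert f c')"
      using x fc c' by (intro theta_le_bdry_len)
    also have "\<dots> \<le> bdry_len F vert edg ends l0 (($) x) (fst (ends e))
        + bdry_len F vert edg ends l0 (($) x) (snd (ends e))"
      using ends_face[OF fc(1,2)] bdry_len_nonneg[OF x] by (auto simp: c'_def fc(3))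
    finally show ?thesis
      using b_le[of "fst (ends e)"] b_le[of "snd (ends e)"] by (simp add: V_def \<beta>_def)
  qed
  then show ?thesis
    using \<delta>(1) by (intro exI[of _ "\<delta> / 2"]) auto
qed

text \<open>In the difference of the opposite and the two adjacent weights the factors of the other
  two corners cancel, so a very negative \<open>x $ i\<close> alone makes it large, and one corner
  at \<open>i\<close> already yields a side longer than every target.\<close>

lemma V_inward_below: "\<exists>m. \<forall>x\<in>W. \<forall>i. x $ i \<le> m \<longrightarrow> 0 \<le> V x $ i"
proof -
  obtain k where k: "\<And>e. e \<in> E \<Longrightarrow> kappa e \<le> k"
    using kappa_bounded by blast
  define \<beta> where "\<beta> = (\<Sum>i\<in>UNIV. b i)"
  have b_le: "b i \<le> \<beta>" for i
    unfolding \<beta>_def using b_pos less_imp_le by (intro member_le_sum) auto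
  have "\<beta> \<ge> 0"
    unfolding \<beta>_def using b_pos less_imp_le by (intro sum_nonneg) auto
  define h where "h = ln (4 * cosh \<beta>)"
  \<comment> \<open>Chosen so that \<open>- 2 * m - 2 * k = h / 2\<close>; doubling and
    exponentiating gives the threshold \<open>4 * cosh \<beta>\<close>.\<close>
  define m where "m = - h / 4 - k"
  have "0 \<le> V x $ i" if x: "x \<in> W" and le: "x $ i \<le> m" for x i
  proof -
    obtain f c where fc: "f \<in> F" "c < 3" "vert f c = i"
      by (rule vertex_occurs)
    note e = edge_in_E'[OF fc(1,2)] edge_in_E[OF fc(1), of "c + 1"] edge_in_E[OF fc(1), of "c + 2"]
    have pos: "edge_wt x (edg f c) > 0" "edge_wt x (edg f ((c + 1) mod 3)) > 0"
      "edge_wt x (edg f ((c + 2) mod 3)) > 0"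
      using x e by (auto simp: W_def)
    have m1: "((c + 1) mod 3 + 1) mod 3 = (c + 2) mod 3" "((c + 1) mod 3 + 2) mod 3 = c"
      "((c + 2) mod 3 + 1) mod 3 = c" "((c + 2) mod 3 + 2) mod 3 = (c + 1) mod 3"
      using fc(2) by (auto simp: mod_simps) presburger
    have "edge_wt x (edg f c) - edge_wt x (edg f ((c + 1) mod 3)) - edge_wt x (edg f ((c + 2) mod 3))
       = - 2 * x $ i + kappa (edg f c) - kappa (edg f ((c + 1) mod 3)) - kappa (edg f ((c + 2) mod 3))"
      using edge_wt_face[OF fc(1,2), of x] edge_wt_face[OF fc(1), of "(c + 1) mod 3" x]
        edge_wt_face[OF fc(1), of "(c + 2) mod 3" x] fc(3) unfolding m1 by simp
    also have "\<dots> \<ge> - 2 * m - 2 * k"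
      using le kappa_nonneg[of "edg f c"] k[OF e(2)] k[OF e(3)] by simp
    finally have "h \<le> 2 * (edge_wt x (edg f c) - edge_wt x (edg f ((c + 1) mod 3))
        - edge_wt x (edg f ((c + 2) mod 3)))"
      unfolding m_def by argo
    then have "exp h \<le> exp (2 * (edge_wt x (edg f c) - edge_wt x (edg f ((c + 1) mod 3))
        - edge_wt x (edg f ((c + 2) mod 3))))"
      by (simp only: exp_le_cancel_iff)
    then have "\<beta> \<le> theta x f c"
      unfolding theta_def using pos \<open>\<beta> \<ge> 0\<close>
      by (intro hexagon_side_ge_opposite) (auto simp: h_def cosh_real_pos)
    also have "\<dots> \<le> bdry_len F vert edg ends l0 (($) x) i"
      using theta_le_bdry_len[OF x fc(1,2)] fc(3) by simp
    finally show ?thesis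
      using b_le[of i] by (simp add: V_def)
  qed
  then show ?thesis
    by blast
qed

text \<open>For \<open>x $ i \<ge> M\<close> the same cancellation bounds the weight difference by
  \<open>k - 2 * M\<close>, while the lower bound \<open>m\<close> on the other factors makes both
  adjacent weights at least \<open>m + M\<close>. As \<open>M\<close> grows, the bound on the
  hyperbolic cosine of every side at \<open>i\<close> tends to 1.\<close>

lemma V_inward_above:
  "\<exists>M. \<forall>x\<in>W. (\<forall>j. m \<le> x $ j) \<longrightarrow> (\<forall>i. M \<le> x $ i \<longrightarrow> V x $ i \<le> 0)"
proof -
  obtain k where k: "\<And>e. e \<in> E \<Longrightarrow> kappa e \<le> k"
    using kappa_bounded by blast
  define n where "n = real (card corners)"
  obtain f0 c0 where "f0 \<in> F" "c0 < 3" "vert f0 c0 = undefined"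
    by (rule vertex_occurs)
  then have "corners \<noteq> {}"
    by (auto simp: corners_def)
  then have "n > 0"
    using finite_corners by (simp add: n_def card_gt_0_iff)
  \<comment> \<open>A component consists of at most \<open>n\<close> sides, so sides of length at
    most \<open>\<beta>\<close> add up to no more than the smallest target.\<close>
  define \<beta> where "\<beta> = Min (range b) / n"
  have "Min (range b) > 0"
    using b_pos by (subst Min_gr_iff) auto
  then have "\<beta> > 0"
    using \<open>n > 0\<close> by (simp add: \<beta>_def)
  have lim: "((\<lambda>M. exp (- (c + a * M))) \<longlongrightarrow> 0) at_top" if "a > 0" for a c :: real
    using that
    by (intro filterlim_compose[OF exp_at_bot])
      (auto simp: filterlim_uminus_at_bot simp del: minus_add_distrib intro!: filterlim_tendsto_add_at_top[OF tendsto_const]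
        filterlim_tendsto_pos_mult_at_top[OF tendsto_const] filterlim_ident)
  have "((\<lambda>M. 2 * exp (- (- 2 * k + 4 * M)) + (1 + exp (- (2 * m + 2 * M)))\<^sup>2) \<longlongrightarrow> 2 * 0 + (1 + 0)\<^sup>2) at_top"
    by (intro tendsto_intros lim) simp_all
  moreover have "1 < cosh \<beta>"
    using \<open>\<beta> > 0\<close> cosh_real_strict_mono[of 0 \<beta>] by simp
  ultimately have "\<forall>\<^sub>F M in at_top. 2 * exp (- (- 2 * k + 4 * M)) + (1 + exp (- (2 * m + 2 * M)))\<^sup>2 < cosh \<beta>"
    by (intro order_tendstoD) auto
  then have "\<forall>\<^sub>F M in at_top. 1 \<le> m + M \<and>
      2 * exp (- (- 2 * k + 4 * M)) + (1 + exp (- (2 * m + 2 * M)))\<^sup>2 < cosh \<beta>"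
    using eventually_ge_at_top[of "1 - m"] by eventually_elim auto
  then obtain M where M: "1 \<le> m + M"
    "2 * exp (- (- 2 * k + 4 * M)) + (1 + exp (- (2 * m + 2 * M)))\<^sup>2 < cosh \<beta>"
    by (auto simp: eventually_at_top_linorder)
  have "V x $ i \<le> 0" if x: "x \<in> W" and m: "\<And>j. m \<le> x $ j" and ge: "M \<le> x $ i" for x i
  proof -
    have "theta x f c \<le> \<beta>" if fc: "f \<in> F" "c < 3" "vert f c = i" for f c
    proof -
      note e = edge_in_E'[OF fc(1,2)] edge_in_E[OF fc(1), of "c + 1"] edge_in_E[OF fc(1), of "c + 2"]
      have m1: "((c + 1) mod 3 + 1) mod 3 = (c + 2) mod 3" "((c + 1) mod 3 + 2) mod 3 = c"
        "((c + 2) mod 3 + 1) mod 3 = c" "((c + 2) mod 3 + 2) mod 3 = (c + 1) mod 3"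
        using fc(2) by (auto simp: mod_simps) presburger
      note s = edge_wt_face[OF fc(1,2), of x] edge_wt_face[OF fc(1), of "(c + 1) mod 3" x, unfolded m1 fc(3)]
        edge_wt_face[OF fc(1), of "(c + 2) mod 3" x, unfolded m1 fc(3)]
      have "edge_wt x (edg f c) - edge_wt x (edg f ((c + 1) mod 3)) - edge_wt x (edg f ((c + 2) mod 3))
         = - 2 * x $ i + kappa (edg f c) - kappa (edg f ((c + 1) mod 3)) - kappa (edg f ((c + 2) mod 3))"
        using s by simp
      also have "\<dots> \<le> k - 2 * M"
        using ge k[OF e(1)] kappa_nonneg[of "edg f ((c + 1) mod 3)"] kappa_nonneg[of "edg f ((c + 2) mod 3)"]
        by simp
      finally have "exp (2 * (edge_wt x (edg f c) - edge_wt x (edg f ((c + 1) mod 3))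
          - edge_wt x (edg f ((c + 2) mod 3)))) \<le> exp (- (- 2 * k + 4 * M))"
        by simp
      then have "2 * exp (2 * (edge_wt x (edg f c) - edge_wt x (edg f ((c + 1) mod 3))
          - edge_wt x (edg f ((c + 2) mod 3)))) + (1 + exp (- (2 * (m + M))))\<^sup>2 \<le> cosh \<beta>"
        using M(2) unfolding distrib_left by linarith
      moreover have "m + M \<le> edge_wt x (edg f ((c + 1) mod 3))"
        using s(2) m[of "vert f ((c + 2) mod 3)"] ge kappa_nonneg[of "edg f ((c + 1) mod 3)"] by simp
      moreover have "m + M \<le> edge_wt x (edg f ((c + 2) mod 3))"
        using s(3) m[of "vert f ((c + 1) mod 3)"] ge kappa_nonneg[of "edg f ((c + 2) mod 3)"] by simp
      moreover have "edge_wt x (edg f c) > 0"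
        using x e(1) by (simp add: W_def)
      ultimately show ?thesis
        unfolding theta_def using M(1) \<open>\<beta> > 0\<close> by (intro hexagon_side_le[where T = "m + M"]) auto
    qed
    then have "bdry_len F vert edg ends l0 (($) x) i \<le> (\<Sum>p\<in>{p\<in>corners. vert (fst p) (snd p) = i}. \<beta>)"
      unfolding bdry_len_eq[OF x] by (intro sum_mono) (auto simp: corners_def)
    also have "\<dots> \<le> (\<Sum>p\<in>corners. \<beta>)"
      using finite_corners \<open>\<beta> > 0\<close> by (intro sum_mono2) auto
    also have "\<dots> = Min (range b)"
      using \<open>n > 0\<close> by (simp add: \<beta>_def n_def)
    also have "\<dots> \<le> b i"
      by simp
    finally show ?thesis
      by (simp add: V_def)
  qed
  then show ?thesis
    by blast
qed

section \<open>The trapping polytope and convergence to the equilibrium\<close>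

lemma flow_converges:
  assumes "x0 \<in> W"
  shows "\<exists>x z lam. x 0 = x0 \<and> z \<in> W \<and> V z = 0 \<and> lam > 0 \<and>
    (\<forall>t\<ge>0. x t \<in> W \<and> (x has_vector_derivative V (x t)) (at t within {0..}) \<and>
      norm (x t - z) \<le> exp (- lam * t) * norm (x0 - z))"
proof -
  obtain \<delta>0 where \<delta>0: "\<delta>0 > 0"
    "\<And>x e. x \<in> W \<Longrightarrow> e \<in> E \<Longrightarrow> edge_wt x e \<le> \<delta>0 \<Longrightarrow> 0 \<le> V x $ fst (ends e) + V x $ snd (ends e)"
    using V_inward_edge by blast
  obtain m0 where m0: "\<And>x i. x \<in> W \<Longrightarrow> x $ i \<le> m0 \<Longrightarrow> 0 \<le> V x $ i"
    using V_inward_below by blast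
  \<comment> \<open>The extrema over \<open>x0\<close> in this and the following constants put the
    initial value into the polytope; the margins 1 and \<open>\<delta>0 / 2\<close> leave room for
    the collar.\<close>
  define m where "m = min (m0 - 1) (Min (range (($) x0)))"
  obtain M0 where M0: "\<And>x i. x \<in> W \<Longrightarrow> (\<And>j. m \<le> x $ j) \<Longrightarrow> M0 \<le> x $ i \<Longrightarrow> V x $ i \<le> 0"
    using V_inward_above[of m] by blast
  define M where "M = max (M0 + 1) (Max (range (($) x0)))"
  define \<delta> where "\<delta> = min (\<delta>0 / 2) (Min (edge_wt x0 ` E))"
  \<comment> \<open>With this width \<open>\<delta> + \<eta> \<le> \<delta>0\<close>,
    \<open>m + \<eta> \<le> m0\<close> and \<open>M - \<eta> \<ge> M0\<close>, so the field is
    inward on the whole collar of each facet.\<close>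
  define \<eta> where "\<eta> = min (\<delta>0 / 2) 1"
  have "Min (edge_wt x0 ` E) > 0"
    using assms finite_E E_nonempty by (subst Min_gr_iff) (auto simp: W_def)
  then have "\<delta> > 0" "\<eta> > 0"
    using \<delta>0(1) by (auto simp: \<delta>_def \<eta>_def)
  define H :: "((real ^ 'v) \<times> real) set" where "H = (\<lambda>e. (axis (fst (ends e)) 1 + axis (snd (ends e)) 1, \<delta> - kappa e)) ` E
    \<union> range (\<lambda>i. (axis i 1, m)) \<union> range (\<lambda>i. (- axis i 1, - M))"
  define K where "K = {x::real^'v. \<forall>(a, c)\<in>H. c \<le> a \<bullet> x}"
  have K: "x \<in> K \<longleftrightarrow> (\<forall>e\<in>E. \<delta> \<le> edge_wt x e) \<and> (\<forall>i. m \<le> x $ i \<and> x $ i \<le> M)" for x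
    by (auto simp: K_def H_def ball_Un inner_add_left inner_axis' edge_wt_def algebra_simps)
  have "finite H"
    using finite_E by (simp add: H_def)
  have K_W: "x \<in> W" if "x \<in> K" for x
    using that \<open>\<delta> > 0\<close> by (force simp: K W_def)
  have "compact K"
  proof -
    have "K = (\<Inter>p\<in>H. {x. snd p \<le> fst p \<bullet> x})"
      unfolding K_def by fastforce
    then have "closed K"
      by (auto intro!: closed_INT closed_halfspace_ge simp: inner_commute)
    moreover have "K \<subseteq> cbox (\<chi> i. m) (\<chi> i. M)"
      by (auto simp: K mem_box_cart)
    ultimately show ?thesis
      using bounded_subset[OF bounded_cbox] by (auto simp: compact_eq_bounded_closed)
  qed
  have "x0 \<in> K"
    using finite_E by (auto simp: K \<delta>_def m_def M_def min_le_iff_disj le_max_iff_disj)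
  obtain k where k: "\<And>e. e \<in> E \<Longrightarrow> kappa e \<le> k"
    using kappa_bounded by blast
  define R where "R = 2 * M + k"
  have K_R: "edge_wt x e \<in> {\<delta>..R}" if "x \<in> K" "e \<in> E" for x e
  proof -
    have "x $ fst (ends e) \<le> M" "x $ snd (ends e) \<le> M" "\<delta> \<le> edge_wt x e"
      using that by (auto simp: K)
    then show ?thesis
      using k[OF that(2)] by (simp add: R_def edge_wt_def)
  qed
  obtain L where "L-lipschitz_on {x. \<forall>e\<in>E. edge_wt x e \<in> {\<delta>..R}} V"
    using V_lipschitz[OF \<open>\<delta> > 0\<close>] by blast
  then have lip: "L-lipschitz_on K V"
    by (rule lipschitz_on_subset) (use K_R in blast)
  have inward: "0 \<le> a \<bullet> V x" if x: "x \<in> K" and "(a, c) \<in> H" and le: "a \<bullet> x \<le> c + \<eta>" for x a c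
    using \<open>(a, c) \<in> H\<close> unfolding H_def
  proof (elim UnE imageE)
    fix e assume e: "(a, c) = (axis (fst (ends e)) 1 + axis (snd (ends e)) 1, \<delta> - kappa e)" "e \<in> E"
    then have "edge_wt x e \<le> \<delta> + \<eta>"
      using le by (simp add: inner_add_left inner_axis' edge_wt_def)
    then have "edge_wt x e \<le> \<delta>0"
      by (simp add: \<delta>_def \<eta>_def)
    then show ?thesis
      using \<delta>0(2)[OF K_W[OF x] e(2)] e(1) by (simp add: inner_add_left inner_axis')
  next
    fix i assume i: "(a, c) = (axis i 1, m)"
    then have "x $ i \<le> m0"
      using le by (simp add: inner_axis' m_def \<eta>_def)
    then show ?thesis
      using m0[OF K_W[OF x]] i by (simp add: inner_axis')
  next
    fix i assume i: "(a, c) = (- axis i 1, - M)"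
    then have "M0 \<le> x $ i"
      using le by (simp add: inner_axis' M_def \<eta>_def)
    then show ?thesis
      using M0[OF K_W[OF x]] x i by (simp add: inner_axis' K)
  qed
  have "\<exists>x\<in>K. V x = 0"
    by (rule polytope_flow_zero[OF K_def \<open>finite H\<close> \<open>compact K\<close> \<open>x0 \<in> K\<close> lip \<open>\<eta> > 0\<close>]) (rule inward)
  then obtain z where z: "z \<in> K" "V z = 0"
    by blast
  have "\<exists>x. x 0 = x0 \<and>
      (\<forall>t\<ge>0. x t \<in> K \<and> (x has_vector_derivative V (x t)) (at t within {0..}))"
    by (rule polytope_flow_exists[OF K_def \<open>finite H\<close> \<open>compact K\<close> \<open>x0 \<in> K\<close> lip \<open>\<eta> > 0\<close>])
      (rule inward)
  then obtain x where x: "x 0 = x0" "\<And>t. t \<ge> 0 \<Longrightarrow> x t \<in> K"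
    "\<And>t. t \<ge> 0 \<Longrightarrow> (x has_vector_derivative V (x t)) (at t within {0..})"
    by blast
  define lam where "lam = monotonicity_const \<delta> R"
  obtain e where "e \<in> E"
    using E_nonempty by blast
  then have "R \<ge> 0"
    using K_R[OF z(1)] \<open>\<delta> > 0\<close> by force
  then have "lam > 0"
    unfolding lam_def using \<open>\<delta> > 0\<close> by (intro monotonicity_const_pos)
  \<comment> \<open>Since \<open>V z = 0\<close>, the constant curve at \<open>z\<close> is a
    solution with which the flow can be compared.\<close>
  have "norm (x t - z) \<le> exp (- lam * t) * norm (x 0 - z)" if "t \<ge> 0" for t
    using that
  proof (intro strongly_monotone_flow_contracts[where V = V and y = "\<lambda>_. z"])
    fix s :: real assume "s \<ge> 0"
    then show "(x s - z) \<bullet> (V (x s) - V z) \<le> - lam * ((x s - z) \<bullet> (x s - z))"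
      unfolding lam_def using x(2) z(1) K_R by (intro V_strongly_monotone \<open>\<delta> > 0\<close>) auto
  qed (use x z in auto)
  then show ?thesis
    using x z \<open>lam > 0\<close> K_W by (metis (no_types))
qed

section \<open>Back to functions on the boundary components\<close>

lemma yamabe_solution_vec:
  assumes "yamabe_solution F vert edg ends l0 b w0 w" "t \<ge> 0"
  shows "(\<chi> i. w t i) \<in> W"
    and "((\<lambda>t. \<chi> i. w t i) has_vector_derivative V (\<chi> i. w t i)) (at t within {0..})"
proof -
  have w: "($) (\<chi> i. w t i) = w t"
    by auto
  show "(\<chi> i. w t i) \<in> W"
    using assms unfolding yamabe_solution_def admissible_iff[symmetric] w by blast
  have "((\<lambda>t. w t i) has_vector_derivative V (\<chi> i. w t i) $ i) (at t within {0..})" for i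
    using assms unfolding yamabe_solution_def has_real_derivative_iff_has_vector_derivative
    by (simp add: V_def w)
  \<comment> \<open>The derivatives of the components are assembled into that of the vector by
    expanding in the standard basis.\<close>
  then have "((\<lambda>t. \<Sum>i\<in>UNIV. w t i *\<^sub>R axis i 1) has_vector_derivative
      (\<Sum>i\<in>UNIV. V (\<chi> i. w t i) $ i *\<^sub>R (axis i 1 :: real ^ 'v))) (at t within {0..})"
    by (intro has_vector_derivative_sum)
      (auto intro!: bounded_linear.has_vector_derivative[OF bounded_linear_scaleR_left])
  moreover have expand: "(\<Sum>i\<in>UNIV. y $ i *\<^sub>R (axis i 1 :: real ^ 'v)) = y" for y
    using basis_expansion[of y] by (simp add: scalar_mult_eq_scaleR)
  moreover have "(\<Sum>i\<in>UNIV. w t i *\<^sub>R (axis i 1 :: real ^ 'v)) = (\<chi> i. w t i)" for t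
    using expand[of "\<chi> i. w t i"] by simp
  ultimately show "((\<lambda>t. \<chi> i. w t i) has_vector_derivative V (\<chi> i. w t i)) (at t within {0..})"
    by simp
qed

lemma yamabe_flow_converges:
  assumes "w0 \<in> admissible F edg ends l0"
  shows "(\<exists>w. yamabe_solution F vert edg ends l0 b w0 w) \<and>
         (\<exists>wstar \<in> admissible F edg ends l0.
            (\<forall>i. bdry_len F vert edg ends l0 wstar i = b i) \<and>
            (\<forall>w. yamabe_solution F vert edg ends l0 b w0 w \<longrightarrow>
               (\<exists>C lam. C > 0 \<and> lam > 0 \<and>
                  (\<forall>t\<ge>0. \<forall>i. \<bar>w t i - wstar i\<bar> \<le> C * exp (- lam * t)))))"
proof -
  define x0 :: "real ^ 'v" where "x0 = (\<chi> i. w0 i)"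
  have w0: "($) x0 = w0"
    by (auto simp: x0_def)
  have "x0 \<in> W"
    using assms unfolding admissible_iff[symmetric] w0 .
  from flow_converges[OF this] obtain x z lam where x0: "x 0 = x0"
    and z: "z \<in> W" "V z = 0" and "lam > 0"
    and x: "\<And>t. t \<ge> 0 \<Longrightarrow> x t \<in> W"
      "\<And>t. t \<ge> 0 \<Longrightarrow> (x has_vector_derivative V (x t)) (at t within {0..})"
      "\<And>t. t \<ge> 0 \<Longrightarrow> norm (x t - z) \<le> exp (- lam * t) * norm (x0 - z)"
    by blast
  have "yamabe_solution F vert edg ends l0 b w0 (\<lambda>t. ($) (x t))"
    unfolding yamabe_solution_def
  proof (intro conjI allI impI)
    fix t :: real and i assume "t \<ge> 0"
    then have "((\<lambda>s. x s $ i) has_vector_derivative V (x t) $ i) (at t within {0..})"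
      by (intro bounded_linear.has_vector_derivative[OF bounded_linear_vec_nth] x)
    then show "((\<lambda>s. x s $ i) has_real_derivative bdry_len F vert edg ends l0 (($) (x t)) i - b i)
        (at t within {0..})"
      by (simp add: V_def has_real_derivative_iff_has_vector_derivative)
  qed (use x x0 w0 admissible_iff in auto)
  moreover have "($) z \<in> admissible F edg ends l0"
    using z admissible_iff by blast
  moreover have "bdry_len F vert edg ends l0 (($) z) i = b i" for i
  proof -
    have "V z $ i = 0"
      using z by simp
    then show ?thesis
      by (simp add: V_def)
  qed
  \<comment> \<open>The summand 1 keeps the constant positive when the flow starts at its
    limit.\<close>
  moreover have "\<bar>w t i - z $ i\<bar> \<le> (norm (x0 - z) + 1) * exp (- lam * t)"
    if w: "yamabe_solution F vert edg ends l0 b w0 w" and "t \<ge> 0" for w t i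
  proof -
    \<comment> \<open>Rate 0 needs monotonicity only. Both curves start at \<open>x0\<close>, so the
      arbitrary solution coincides with the constructed one and inherits its decay.\<close>
    have "norm ((\<chi> i. w t i) - x t) \<le> exp (- 0 * t) * norm ((\<chi> i. w 0 i) - x 0)"
    proof (rule strongly_monotone_flow_contracts[where V = V])
      fix s :: real assume "s \<ge> 0"
      then show "((\<chi> i. w s i) - x s) \<bullet> (V (\<chi> i. w s i) - V (x s))
          \<le> - 0 * (((\<chi> i. w s i) - x s) \<bullet> ((\<chi> i. w s i) - x s))"
        using V_monotone yamabe_solution_vec(1)[OF w] x(1) by simp
    qed (use w x yamabe_solution_vec \<open>t \<ge> 0\<close> in auto)
    moreover have "w 0 = w0"
      using w by (simp add: yamabe_solution_def)
    ultimately have "(\<chi> i. w t i) = x t"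
      by (simp add: x0 x0_def)
    then have "w t i = x t $ i"
      by (metis vec_lambda_beta)
    then have "\<bar>w t i - z $ i\<bar> \<le> norm (x t - z)"
      using component_le_norm_cart[of "x t - z" i] by simp
    also have "\<dots> \<le> exp (- lam * t) * norm (x0 - z)"
      using x(3) \<open>t \<ge> 0\<close> .
    also have "\<dots> \<le> (norm (x0 - z) + 1) * exp (- lam * t)"
      by (simp add: algebra_simps)
    finally show ?thesis .
  qed
  moreover have "norm (x0 - z) + 1 > 0"
    using norm_ge_zero[of "x0 - z"] by linarith
  ultimately show ?thesis
    using \<open>lam > 0\<close> by blast
qed

end

theorem theorem1p2:
  fixes F :: "'f set" and vert :: "'f \<Rightarrow> nat \<Rightarrow> 'v::finite"
    and edg :: "'f \<Rightarrow> nat \<Rightarrow> 'e" and ends :: "'e \<Rightarrow> 'v \<times> 'v"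
    and l0 :: "'e \<Rightarrow> real" and b :: "'v \<Rightarrow> real" and w0 :: "'v \<Rightarrow> real"
  assumes "tri_data F vert edg ends"
    and "\<forall>e\<in>edges_of F edg. l0 e > 0"
    and "\<forall>i. b i > 0"
    and "w0 \<in> admissible F edg ends l0"
  shows "(\<exists>w. yamabe_solution F vert edg ends l0 b w0 w) \<and>
         (\<exists>wstar \<in> admissible F edg ends l0.
            (\<forall>i. bdry_len F vert edg ends l0 wstar i = b i) \<and>
            (\<forall>w. yamabe_solution F vert edg ends l0 b w0 w \<longrightarrow>
               (\<exists>C lam. C > 0 \<and> lam > 0 \<and>
                  (\<forall>t\<ge>0. \<forall>i. \<bar>w t i - wstar i\<bar> \<le> C * exp (- lam * t)))))"
proof -
  interpret ideal_triangulation F vert edg ends l0 b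
    using assms by unfold_locales auto
  show ?thesis
    using assms(4) by (rule yamabe_flow_converges)
qed

end
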